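(* Let $G=(V,E)$ be a multigraph with $m$ edges (loops counted). Let $\mathcal P$ be the poset, ordered by inclusion, of all subsets $H\subseteq E$ such that the graph $(V,H)$ has no bridge (equivalently, $H$ is a union of cycles of $G$; $\emptyset\in\mathcal P$), and let $\mu(H)=\mu_{\mathcal P}(\emptyset,H)$ be its Möbius function. Then $$h^\ast(\mathcal C_G;z)=\sum_{H\in\mathcal P}\mu(H)\,(2z)^{|H|}(1+3z)^{m-|H|}.$$
   Context: For a finite undirected multigraph $G=(V,E)$ (loops, parallel edges and isolated nodes allowed) with $n=|V|$, $m=|E|$, work in $\mathbb{R}^V\times\mathbb{R}^E\cong\mathbb{R}^{n+m}$ with standard basis vectors $e_u$, $e_f$. For each edge $f$ with endpoints $u,v$ ($u=v$ for a loop) set $\widetilde e_f=e_u+e_v-e_f$, $\overleftarrow e_f=e_u-e_v+e_f$, $\overrightarrow e_f=-e_u+e_v+e_f$. The cosmological polytope $\mathcal C_G$ is the convex hull of $\{e_f,\widetilde e_f,\overleftarrow e_f,\overrightarrow e_f: f\in E\}\cup\{e_u: u\in V\}$, a lattice polytope of dimension $n+m-1$. For a $d$-dimensional lattice polytope $P\subseteq\mathbb{R}^N$, the $h^\ast$-polynomial is defined by $\sum_{j\ge0}|jP\cap\mathbb{Z}^N|z^j=h^\ast(P;z)/(1-z)^{d+1}$. The Möbius function of a finite poset is the unique $\mu$ with $\mu(s,s)=1$, $\mu(s,t)=0$ unless $s\le t$, and $\sum_{s\le r\le t}\mu(s,r)=0$ for $s<t$. *)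

theory Defs
  imports "HOL-Analysis.Analysis" "HOL-Computational_Algebra.Polynomial_FPS"
begin

text \<open>A finite multigraph: vertex set V (a subset of a finite type 'v), edge set E
(a subset of a finite type 'e), and an endpoint map ends (orientation irrelevant;
a loop has equal endpoints).  The ambient space is real^('v + 'e); coordinates
outside V and E are identically zero on the polytope and do not affect anything.\<close>

definition cosmo_gens ::
  "'v::finite set \<Rightarrow> 'e::finite set \<Rightarrow> ('e \<Rightarrow> 'v \<times> 'v) \<Rightarrow> (real ^ ('v + 'e)) set" where
  "cosmo_gens V E ends =
     {axis (Inr f) 1 | f. f \<in> E}
   \<union> {axis (Inl (fst (ends f))) 1 + axis (Inl (snd (ends f))) 1 - axis (Inr f) 1 | f. f \<in> E}
   \<union> {axis (Inl (fst (ends f))) 1 - axis (Inl (snd (ends f))) 1 + axis (Inr f) 1 | f. f \<in> E}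
   \<union> {- axis (Inl (fst (ends f))) 1 + axis (Inl (snd (ends f))) 1 + axis (Inr f) 1 | f. f \<in> E}
   \<union> {axis (Inl u) 1 | u. u \<in> V}"

definition cosmological_polytope ::
  "'v::finite set \<Rightarrow> 'e::finite set \<Rightarrow> ('e \<Rightarrow> 'v \<times> 'v) \<Rightarrow> (real ^ ('v + 'e)) set" where
  "cosmological_polytope V E ends = convex hull (cosmo_gens V E ends)"

definition lattice_count :: "(real ^ 'n::finite) set \<Rightarrow> nat \<Rightarrow> nat" where
  "lattice_count P j = card {x. x \<in> (\<lambda>y. real j *\<^sub>R y) ` P \<and> (\<forall>i. x $ i \<in> \<int>)}"

definition ehrhart_series :: "(real ^ 'n::finite) set \<Rightarrow> int fps" where
  "ehrhart_series P = Abs_fps (\<lambda>j. int (lattice_count P j))"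

definition h_star :: "(real ^ 'n::finite) set \<Rightarrow> int poly" where
  "h_star P = (THE h. fps_of_poly h = ehrhart_series P * (1 - fps_X) ^ (nat (aff_dim P) + 1))"

definition adj :: "('e \<Rightarrow> 'v \<times> 'v) \<Rightarrow> 'e set \<Rightarrow> 'v \<Rightarrow> 'v \<Rightarrow> bool" where
  "adj ends H x y \<longleftrightarrow> (\<exists>f\<in>H. ends f = (x, y) \<or> ends f = (y, x))"

definition is_bridge :: "('e \<Rightarrow> 'v \<times> 'v) \<Rightarrow> 'e set \<Rightarrow> 'e \<Rightarrow> bool" where
  "is_bridge ends H f \<longleftrightarrow> f \<in> H \<and> \<not> (adj ends (H - {f}))\<^sup>*\<^sup>* (fst (ends f)) (snd (ends f))"

definition bridgeless :: "('e \<Rightarrow> 'v \<times> 'v) \<Rightarrow> 'e set \<Rightarrow> bool" where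
  "bridgeless ends H \<longleftrightarrow> (\<forall>f\<in>H. \<not> is_bridge ends H f)"

definition bridgeless_poset :: "'e set \<Rightarrow> ('e \<Rightarrow> 'v \<times> 'v) \<Rightarrow> 'e set set" where
  "bridgeless_poset E ends = {H. H \<subseteq> E \<and> bridgeless ends H}"

definition mobius :: "'a set set \<Rightarrow> 'a set \<Rightarrow> 'a set \<Rightarrow> int" where
  "mobius P = (THE mu.
      (\<forall>s t. (s \<notin> P \<or> t \<notin> P) \<longrightarrow> mu s t = 0)
    \<and> (\<forall>s\<in>P. mu s s = 1)
    \<and> (\<forall>s\<in>P. \<forall>t\<in>P. \<not> s \<subseteq> t \<longrightarrow> mu s t = 0)
    \<and> (\<forall>s\<in>P. \<forall>t\<in>P. s \<subset> t \<longrightarrow> (\<Sum>r\<in>{r\<in>P. s \<subseteq> r \<and> r \<subseteq> t}. mu s r) = 0))"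

end

(* Let x(S) = sum of x over S and y+ = max 0 y. All generators have coordinate sum 1, so j C_G is
   the slice "coordinate sum = j" of the cone over C_G. Subtracting max 0 (-y_f) (e_u + e_v) for
   each edge f = uv turns the cone into
     {(x, y). x(S) + (sum of y+ over the edges leaving S) >= 0 for all S},
   graded by x(V) + sum |y_f|; submodularity of the left-hand side gives an integral decomposition
   into generators. For an edge f = uv, the points with y_f = t > 0 arise from those with y_f = 0 by
   thickening by t on both sides along the direction e_u - e_v. The fibres along this direction are
   intervals indexed by the points of the contraction G/f, so the Ehrhart series satisfies
     L_G = (1+z)/(1-z) L_(G-f) + 2z/(1-z)^2 L_(G/f)   (without the last term if f is a loop).
   Hence h* is the sum of (2z)^|I| (1+z)^(m-|I|) over the forests I. Expanding
   1+3z = 2z + (1+z) in the claimed formula yields the same sum, because the bridgeless subsets of A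
   have a largest element, so the sum of mu over them is 1 if A is a forest and 0 otherwise. *)

theory Submission
  imports Defs
begin

text \<open>The only generator with a negative coordinate at f is e_u + e_v - e_f, so the
  substitution splits off all copies of it. It is piecewise linear and bijective on integer points,
  and afterwards a negative y_f costs only degree. What remains is a flow problem: y_f > 0 allows up
  to y_f units to move between the ends of f, paid by that many copies of an arrow generator, and
  copies of e_f use up the rest. The obstacle is integrality. For one edge the admissible shifts i
  are bounded below by integers coming from the sets with u but not v, and above by integers coming
  from the sets with v but not u. Submodularity puts every lower bound below every upper bound, so
  an integer fits. The same argument with unrestricted shifts identifies the quotient along e_u -
  e_v with the cone of G/f. The coefficients of the recursion: the two signs of t = y_f give 1 + 2z
  + 2z^2 + ... = (1+z)/(1-z), and thickening adds 2t points per fibre for t > 0 only, with sum of 2t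
  z^t equal to 2z/(1-z)^2. Contraction loses a node and an edge, which absorbs (1-z)^2.\<close>

section \<open>Forests, bridges and contraction\<close>

text \<open>Acyclicity in the form in which the Moebius sum meets it: the empty set is the only
  element of the poset below \<open>I\<close>.\<close>

definition forest :: "('e \<Rightarrow> 'v \<times> 'v) \<Rightarrow> 'e set \<Rightarrow> bool" where
  "forest ends I \<longleftrightarrow> (\<forall>H. H \<subseteq> I \<and> bridgeless ends H \<longrightarrow> H = {})"

text \<open>The vertex \<open>v\<close> is redirected to \<open>u\<close> within the same type, so
  it only becomes isolated. The contracted edge is not removed here: it is left out of the edge set.
  Edges parallel to it become loops.\<close>

definition contract :: "'v \<Rightarrow> 'v \<Rightarrow> ('e \<Rightarrow> 'v \<times> 'v) \<Rightarrow> 'e \<Rightarrow> 'v \<times> 'v" where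
  "contract u v ends = map_prod (id(v := u)) (id(v := u)) \<circ> ends"

lemma adj_sym: "adj ends H a b \<Longrightarrow> adj ends H b a"
  by (auto simp: adj_def)

lemma conn_sym: "(adj ends H)\<^sup>*\<^sup>* a b \<Longrightarrow> (adj ends H)\<^sup>*\<^sup>* b a"
  by (induction rule: rtranclp_induct) (auto intro: adj_sym converse_rtranclp_into_rtranclp)

lemma conn_mono: "(adj ends H)\<^sup>*\<^sup>* a b \<Longrightarrow> H \<subseteq> K \<Longrightarrow> (adj ends K)\<^sup>*\<^sup>* a b"
  by (erule rtranclp_mono[THEN predicate2D, rotated]) (fastforce simp: adj_def)

lemma not_bridge_mono:
  assumes "\<not> is_bridge ends H f" "f \<in> H" "H \<subseteq> K"
  shows "\<not> is_bridge ends K f"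
  using assms conn_mono[of ends "H - {f}" _ _ "K - {f}"] by (auto simp: is_bridge_def)

text \<open>Enlarging the edge set only adds detours around an edge. This closure under unions is
  what provides a largest bridgeless subset of any edge set.\<close>

lemma bridgeless_Union:
  assumes "\<And>H. H \<in> C \<Longrightarrow> bridgeless ends H"
  shows "bridgeless ends (\<Union>C)"
  using assms unfolding bridgeless_def by (meson Union_iff Union_upper not_bridge_mono)

lemma bridgeless_empty [simp]: "bridgeless ends {}"
  by (simp add: bridgeless_def)

text \<open>Vertices with the same image are equal or joined by \<open>f\<close>, so walks lift and
  project.\<close>

lemma conn_contract:
  assumes f: "ends f = (u, v)"
  shows "(adj (contract u v ends) H)\<^sup>*\<^sup>* ((id(v := u)) a) ((id(v := u)) b) \<longleftrightarrow>
    (adj ends (insert f H))\<^sup>*\<^sup>* a b" (is "?C\<^sup>*\<^sup>* (?r a) (?r b) \<longleftrightarrow> ?A\<^sup>*\<^sup>* a b")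
proof
  have same: "?A\<^sup>*\<^sup>* a b" if "?r a = ?r b" for a b
  proof -
    have "?A u v" "?A v u" using f by (auto simp: adj_def)
    with that show ?thesis by (auto split: if_splits)
  qed
  \<comment> \<open>The preimage of the endpoint is left arbitrary because each lifted edge may
    leave from the other vertex of the pair \<open>u\<close>, \<open>v\<close>.\<close>
  have "?C\<^sup>*\<^sup>* p q \<Longrightarrow> ?r a = p \<Longrightarrow> ?r b = q \<Longrightarrow> ?A\<^sup>*\<^sup>* a b" for p q a b
  proof (induction arbitrary: b rule: rtranclp_induct)
    case base
    then show ?case using same by simp
  next
    case (step q' q)
    obtain e where e: "e \<in> H" "contract u v ends e = (q', q) \<or> contract u v ends e = (q, q')"
      using step.hyps(2) by (auto simp: adj_def)
    obtain c d where cd: "ends e = (c, d)" by force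
    then have "contract u v ends e = (?r c, ?r d)" by (simp add: contract_def)
    with e(2) cd obtain a' b' where a': "ends e = (a', b') \<or> ends e = (b', a')" "?r a' = q'" "?r b' = q"
      by (metis prod.inject)
    have "?A\<^sup>*\<^sup>* a a'" by (rule step.IH[OF step.prems(1) a'(2)])
    also have "?A a' b'" using a'(1) e(1) by (auto simp: adj_def)
    also have "?A\<^sup>*\<^sup>* b' b" by (rule same) (use a' step.prems in simp)
    finally show ?case .
  qed
  then show "?C\<^sup>*\<^sup>* (?r a) (?r b) \<Longrightarrow> ?A\<^sup>*\<^sup>* a b" by blast
next
  assume "?A\<^sup>*\<^sup>* a b"
  then show "?C\<^sup>*\<^sup>* (?r a) (?r b)"
  proof (induction rule: rtranclp_induct)
    case (step x y)
    obtain e where e: "e \<in> insert f H" "ends e = (x, y) \<or> ends e = (y, x)"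
      using step.hyps(2) by (auto simp: adj_def)
    show ?case
    proof (cases "e \<in> H")
      case True
      then have "?C (?r x) (?r y)" using e(2) unfolding adj_def contract_def
        by (intro bexI[of _ e]) auto
      with step.IH show ?thesis by (rule rtranclp.rtrancl_into_rtrancl)
    next
      case False
      then have "?r x = ?r y" using e f by auto
      with step.IH show ?thesis by simp
    qed
  qed simp
qed

lemma is_bridge_contract:
  assumes "ends f = (u, v)" "g \<in> H" "f \<notin> H"
  shows "is_bridge (contract u v ends) H g \<longleftrightarrow> is_bridge ends (insert f H) g"
proof -
  have "insert f (H - {g}) = insert f H - {g}" using assms by auto
  then show ?thesis using conn_contract[of ends f u v "H - {g}" "fst (ends g)" "snd (ends g)"] assms
    unfolding is_bridge_def by (auto simp: contract_def)
qed

text \<open>A walk can be shortened until it crosses \<open>f\<close> at most once; the last two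
  disjuncts are the two directions of the crossing.\<close>

lemma conn_insert:
  assumes f: "ends f = (u, v)" and ab: "(adj ends (insert f A))\<^sup>*\<^sup>* a b"
  shows "(adj ends A)\<^sup>*\<^sup>* a b \<or> ((adj ends A)\<^sup>*\<^sup>* a u \<and> (adj ends A)\<^sup>*\<^sup>* v b)
    \<or> ((adj ends A)\<^sup>*\<^sup>* a v \<and> (adj ends A)\<^sup>*\<^sup>* u b)"
  using ab
proof (induction rule: rtranclp_induct)
  case (step x y)
  then consider "adj ends A x y" | "x = u" "y = v" | "x = v" "y = u"
    using f by (auto simp: adj_def)
  then show ?case
  proof cases
    case 1 then show ?thesis using step.IH by (meson rtranclp.rtrancl_into_rtrancl)
  qed (use step.IH in auto)
qed simp

text \<open>Contraction preserves which edges other than \<open>f\<close> are bridges, so only two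
  points need care: whether \<open>f\<close> itself is a bridge of \<open>insert f H\<close>, and
  whether \<open>{f}\<close> alone is bridgeless, which happens exactly for a loop.\<close>

lemma forest_insert:
  assumes fI: "f \<notin> I" and f: "ends f = (u, v)"
  shows "forest ends (insert f I) \<longleftrightarrow> u \<noteq> v \<and> forest (contract u v ends) I"
proof (intro iffI conjI)
  assume F: "forest ends (insert f I)"
  show "u \<noteq> v"
  proof
    assume "u = v"
    then have "bridgeless ends {f}" using f by (auto simp: bridgeless_def is_bridge_def)
    with F show False unfolding forest_def by blast
  qed
  show "forest (contract u v ends) I"
    unfolding forest_def
  proof safe
    fix H g assume H: "H \<subseteq> I" "bridgeless (contract u v ends) H" and gH: "g \<in> H"
    have fH: "f \<notin> H" using H fI by auto
    have nb: "\<not> is_bridge ends (insert f H) g" if "g \<in> H" for g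
      using H(2) that is_bridge_contract[of ends f u v g H] f fH unfolding bridgeless_def by blast
    have bf: "is_bridge ends (insert f H) f"
    proof (rule ccontr)
      assume "\<not> ?thesis"
      then have "bridgeless ends (insert f H)" using nb by (auto simp: bridgeless_def)
      with F H(1) show False unfolding forest_def by blast
    qed
    then have uv: "\<not> (adj ends H)\<^sup>*\<^sup>* u v" using f fH by (auto simp: is_bridge_def)
    \<comment> \<open>If \<open>g\<close> were a bridge of \<open>H\<close>, its detour in
      \<open>insert f H\<close> would have to cross \<open>f\<close>. Closed up along
      \<open>g\<close>, the rest of the detour joins \<open>u\<close> to \<open>v\<close> inside
      \<open>H\<close>, although \<open>f\<close> is a bridge.\<close>
    have "bridgeless ends H" unfolding bridgeless_def
    proof safe
      fix g assume g: "g \<in> H" and bg: "is_bridge ends H g"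
      obtain x y where xy: "ends g = (x, y)" by force
      let ?A = "adj ends (H - {g})"
      have "insert f (H - {g}) = insert f H - {g}" using g fH by auto
      then have "(adj ends (insert f (H - {g})))\<^sup>*\<^sup>* x y"
        using nb[OF g] g xy by (auto simp: is_bridge_def)
      from conn_insert[of ends f u v, OF f this] bg xy
      have "(?A\<^sup>*\<^sup>* x u \<and> ?A\<^sup>*\<^sup>* v y) \<or> (?A\<^sup>*\<^sup>* x v \<and> ?A\<^sup>*\<^sup>* u y)"
        by (auto simp: is_bridge_def)
      then have "((adj ends H)\<^sup>*\<^sup>* x u \<and> (adj ends H)\<^sup>*\<^sup>* v y) \<or> ((adj ends H)\<^sup>*\<^sup>* x v \<and> (adj ends H)\<^sup>*\<^sup>* u y)"
        by (meson Diff_subset conn_mono)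
      moreover have "adj ends H x y" using g xy by (auto simp: adj_def)
      ultimately have "(adj ends H)\<^sup>*\<^sup>* u v"
        by (meson adj_sym conn_sym converse_rtranclp_into_rtranclp rtranclp_trans)
      with uv show False ..
    qed
    with F H(1) have "H = {}" unfolding forest_def by blast
    with gH show "g \<in> {}" by simp
  qed
next
  assume "u \<noteq> v \<and> forest (contract u v ends) I"
  then have uv: "u \<noteq> v" and F: "forest (contract u v ends) I" by auto
  show "forest ends (insert f I)" unfolding forest_def
  proof (intro allI impI)
    fix H assume H: "H \<subseteq> insert f I \<and> bridgeless ends H"
    have "bridgeless (contract u v ends) (H - {f})" unfolding bridgeless_def
    proof
      fix g assume g: "g \<in> H - {f}"
      then have "\<not> is_bridge ends (insert f (H - {f})) g"
        using H not_bridge_mono[of ends H g "insert f (H - {f})"] by (auto simp: bridgeless_def)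
      then show "\<not> is_bridge (contract u v ends) (H - {f}) g"
        using is_bridge_contract[of ends f u v g "H - {f}"] f g by blast
    qed
    then have "H - {f} = {}" using F H unfolding forest_def by blast
    moreover have "\<not> bridgeless ends {f}"
    proof -
      have "adj ends {} = (\<lambda>_ _. False)" by (auto simp: adj_def fun_eq_iff)
      then show ?thesis using f uv by (auto simp: bridgeless_def is_bridge_def elim: rtranclp.cases)
    qed
    ultimately show "H = {}" using H by (metis Diff_eq_empty_iff subset_singleton_iff)
  qed
qed

lemma forest_empty [simp]: "forest ends {}"
  by (simp add: forest_def)

section \<open>The forest polynomial and its deletion-contraction rule\<close>

definition forests :: "'e set \<Rightarrow> ('e \<Rightarrow> 'v \<times> 'v) \<Rightarrow> 'e set set" where
  "forests E ends = {I. I \<subseteq> E \<and> forest ends I}"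

lemma finite_forests: "finite E \<Longrightarrow> finite (forests E ends)"
  by (auto simp: forests_def)

text \<open>The factors 2z and 1+z are the numerators of the contraction term and the deletion term
  in the recursion for the Ehrhart series.\<close>

definition forest_poly :: "'e set \<Rightarrow> ('e \<Rightarrow> 'v \<times> 'v) \<Rightarrow> int poly" where
  "forest_poly E ends = (\<Sum>I\<in>forests E ends. [:0, 2:] ^ card I * [:1, 1:] ^ (card E - card I))"

lemma forest_poly_empty: "forest_poly {} ends = 1"
proof -
  have "forests {} ends = {{}}" by (auto simp: forests_def)
  then show ?thesis by (simp add: forest_poly_def)
qed

text \<open>Forests without \<open>f\<close> are the forests of the deletion; removing
  \<open>f\<close> from the others gives the forests of the contraction.\<close>

lemma forest_poly_insert:
  assumes fin: "finite E" and f: "f \<notin> E" "ends f = (u, v)"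
  shows "forest_poly (insert f E) ends = [:1, 1:] * forest_poly E ends
    + (if u = v then 0 else [:0, 2:] * forest_poly E (contract u v ends))"
proof -
  define a b :: "int poly" where "a = [:0, 2:]" and "b = [:1, 1:]"
  have fp: "forest_poly E' ends' = (\<Sum>I\<in>forests E' ends'. a ^ card I * b ^ (card E' - card I))"
    for E' and ends' :: "'a \<Rightarrow> 'b \<times> 'b" by (simp only: forest_poly_def a_def b_def)
  let ?g = "\<lambda>I. a ^ card I * b ^ (card (insert f E) - card I) "
  \<comment> \<open>Empty for a loop, so that one disjoint decomposition serves both cases.\<close>
  define J where "J = (if u = v then {} else forests E (contract u v ends))"
  have J: "I \<in> J \<longleftrightarrow> u \<noteq> v \<and> I \<subseteq> E \<and> forest (contract u v ends) I" for I
    by (simp add: J_def forests_def)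
  have "finite J" using fin by (simp add: J_def finite_forests)
  have "forests (insert f E) ends = forests E ends \<union> insert f ` J"
  proof (rule set_eqI)
    fix I
    show "I \<in> forests (insert f E) ends \<longleftrightarrow> I \<in> forests E ends \<union> insert f ` J"
    proof (cases "f \<in> I")
      case True
      then obtain I' where I: "I = insert f I'" "f \<notin> I'" by (meson mk_disjoint_insert)
      have "I \<in> forests (insert f E) ends \<longleftrightarrow> I' \<in> J"
        using forest_insert[of f I' ends u v] f I by (auto simp: forests_def J)
      moreover have "I \<in> insert f ` J \<longleftrightarrow> I' \<in> J"
      proof
        assume "I \<in> insert f ` J"
        then obtain I'' where "I'' \<in> J" "I = insert f I''" by auto
        moreover from this have "f \<notin> I''" using f(1) by (auto simp: J)
        ultimately show "I' \<in> J" using I by (metis insert_ident)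
      qed (use I in auto)
      moreover have "I \<notin> forests E ends" using True f(1) by (auto simp: forests_def)
      ultimately show ?thesis by blast
    next
      case False
      then show ?thesis by (auto simp: forests_def)
    qed
  qed
  moreover have "forests E ends \<inter> insert f ` J = {}" using f by (auto simp: forests_def J)
  moreover have "inj_on (insert f) J"
  proof (rule inj_onI)
    fix I I' assume "I \<in> J" "I' \<in> J" "insert f I = insert f I'"
    moreover from this have "f \<notin> I" "f \<notin> I'" using f(1) by (auto simp: J)
    ultimately show "I = I'" by (metis insert_ident)
  qed
  ultimately have "forest_poly (insert f E) ends = sum ?g (forests E ends) + (\<Sum>I\<in>J. ?g (insert f I))"
    unfolding fp using finite_forests[OF fin] \<open>finite J\<close>
    by (metis (no_types, lifting) sum.union_disjoint finite_imageI sum.reindex_cong)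
  also have "sum ?g (forests E ends) = b * forest_poly E ends"
    unfolding fp sum_distrib_left
  proof (rule sum.cong)
    fix I assume "I \<in> forests E ends"
    then have "card I \<le> card E" using fin by (auto simp: forests_def card_mono)
    then show "?g I = b * (a ^ card I * b ^ (card E - card I))"
      using fin f by (simp add: Suc_diff_le mult.left_commute)
  qed simp
  also have "(\<Sum>I\<in>J. ?g (insert f I)) = (if u = v then 0 else a * forest_poly E (contract u v ends))"
  proof (cases "u = v")
    case False
    then have "J = forests E (contract u v ends)" by (simp add: J_def)
    then have *: "a * forest_poly E (contract u v ends) = (\<Sum>I\<in>J. a * (a ^ card I * b ^ (card E - card I)))"
      unfolding fp sum_distrib_left by (simp only:)
    have "?g (insert f I) = a * (a ^ card I * b ^ (card E - card I))" if "I \<in> J" for I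
    proof -
      have "f \<notin> I" "finite I" using that f fin finite_subset by (auto simp: J)
      then show ?thesis using fin f by (simp add: mult.assoc)
    qed
    then show ?thesis using False * by (simp only: if_False cong: sum.cong)
  qed (simp add: J_def)
  finally show ?thesis by (simp only: a_def b_def)
qed

section \<open>The Moebius function of the bridgeless poset\<close>

text \<open>The vanishing interval sum solved for its top term; this is the existence half behind
  the definite description in \<open>mobius\<close>.\<close>

function mobius_rec :: "'a::finite set set \<Rightarrow> 'a set \<Rightarrow> 'a set \<Rightarrow> int" where
  "mobius_rec P s t = (if s \<notin> P \<or> t \<notin> P \<or> \<not> s \<subseteq> t then 0 else if s = t then 1
     else - (\<Sum>r\<in>{r\<in>P. s \<subseteq> r \<and> r \<subset> t}. mobius_rec P s r))"
  by auto
termination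
  by (relation "Wellfounded.measure (\<lambda>(P, s, t). card t)") (auto intro: psubset_card_mono)

declare mobius_rec.simps [simp del]

lemma sum_interval_split:
  fixes P :: "'a::finite set set"
  assumes "s \<in> P" "t \<in> P" "s \<subset> t"
  shows "(\<Sum>r\<in>{r\<in>P. s \<subseteq> r \<and> r \<subseteq> t}. (g r :: int)) = g t + (\<Sum>r\<in>{r\<in>P. s \<subseteq> r \<and> r \<subset> t}. g r)"
proof -
  have "{r\<in>P. s \<subseteq> r \<and> r \<subseteq> t} = insert t {r\<in>P. s \<subseteq> r \<and> r \<subset> t}" using assms by auto
  then show ?thesis by simp
qed

text \<open>Uniqueness is induction on \<open>card t\<close>: the interval condition determines
  \<open>mu s t\<close> from the values at proper subsets of \<open>t\<close>.\<close>

lemma mobius_eq_rec: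
  fixes P :: "'a::finite set set"
  shows "mobius P = mobius_rec P"
  unfolding mobius_def
proof (rule the_equality)
  show "(\<forall>s t. (s \<notin> P \<or> t \<notin> P) \<longrightarrow> mobius_rec P s t = 0)
    \<and> (\<forall>s\<in>P. mobius_rec P s s = 1)
    \<and> (\<forall>s\<in>P. \<forall>t\<in>P. \<not> s \<subseteq> t \<longrightarrow> mobius_rec P s t = 0)
    \<and> (\<forall>s\<in>P. \<forall>t\<in>P. s \<subset> t \<longrightarrow> (\<Sum>r\<in>{r\<in>P. s \<subseteq> r \<and> r \<subseteq> t}. mobius_rec P s r) = 0)"
  proof (intro conjI ballI allI impI)
    fix s t assume st: "s \<in> P" "t \<in> P" "s \<subset> t"
    then have "mobius_rec P s t = - (\<Sum>r\<in>{r\<in>P. s \<subseteq> r \<and> r \<subset> t}. mobius_rec P s r)"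
      by (subst mobius_rec.simps) auto
    then show "(\<Sum>r\<in>{r\<in>P. s \<subseteq> r \<and> r \<subseteq> t}. mobius_rec P s r) = 0"
      using sum_interval_split[OF st] by simp
  qed (subst mobius_rec.simps; auto)+
next
  fix mu :: "'a set \<Rightarrow> 'a set \<Rightarrow> int"
  assume mu: "(\<forall>s t. (s \<notin> P \<or> t \<notin> P) \<longrightarrow> mu s t = 0)
    \<and> (\<forall>s\<in>P. mu s s = 1)
    \<and> (\<forall>s\<in>P. \<forall>t\<in>P. \<not> s \<subseteq> t \<longrightarrow> mu s t = 0)
    \<and> (\<forall>s\<in>P. \<forall>t\<in>P. s \<subset> t \<longrightarrow> (\<Sum>r\<in>{r\<in>P. s \<subseteq> r \<and> r \<subseteq> t}. mu s r) = 0)"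
  have "mu s t = mobius_rec P s t" for s t
  proof (induction "card t" arbitrary: t rule: less_induct)
    case less
    show ?case
    proof (cases "s \<in> P \<and> t \<in> P \<and> s \<subset> t")
      case True
      then have "mu s t = - (\<Sum>r\<in>{r\<in>P. s \<subseteq> r \<and> r \<subset> t}. mu s r)"
        using mu sum_interval_split[of s P t "mu s"] by auto
      also have "\<dots> = - (\<Sum>r\<in>{r\<in>P. s \<subseteq> r \<and> r \<subset> t}. mobius_rec P s r)"
        by (intro arg_cong[where f = uminus] sum.cong refl less psubset_card_mono) auto
      also have "\<dots> = mobius_rec P s t" using True by (subst (2) mobius_rec.simps) auto
      finally show ?thesis .
    next
      case False
      then consider "s \<notin> P \<or> t \<notin> P \<or> \<not> s \<subseteq> t" | "s \<in> P" "s = t" by blast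
      then show ?thesis
      proof cases
        case 1
        then have "mu s t = 0"
          using mu[THEN conjunct1] mu[THEN conjunct2, THEN conjunct2, THEN conjunct1] by metis
        then show ?thesis using 1 by (subst mobius_rec.simps) simp
      next
        case 2
        then have "mu s t = 1" using mu[THEN conjunct2, THEN conjunct1] by simp
        then show ?thesis using 2 by (subst mobius_rec.simps) simp
      qed
    qed
  qed
  then show "mu = mobius_rec P" by blast
qed

lemma mobius_sum_interval:
  fixes P :: "'a::finite set set"
  assumes "s \<in> P" "t \<in> P" "s \<subseteq> t"
  shows "(\<Sum>r\<in>{r\<in>P. s \<subseteq> r \<and> r \<subseteq> t}. mobius P s r) = (if s = t then 1 else 0)"
proof (cases "s = t")
  case True
  then have "{r\<in>P. s \<subseteq> r \<and> r \<subseteq> t} = {s}" using assms by auto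
  then show ?thesis using True assms by (simp add: mobius_eq_rec mobius_rec.simps)
next
  case False
  then have "s \<subset> t" using assms by auto
  moreover from this have "mobius P s t = - (\<Sum>r\<in>{r\<in>P. s \<subseteq> r \<and> r \<subset> t}. mobius P s r)"
    using assms unfolding mobius_eq_rec by (subst mobius_rec.simps) auto
  ultimately show ?thesis using sum_interval_split[of s P t "mobius P s"] assms by simp
qed

lemma sum_mobius_bridgeless:
  fixes ends :: "'e::finite \<Rightarrow> 'v \<times> 'v"
  assumes "A \<subseteq> E"
  shows "(\<Sum>H\<in>{H\<in>bridgeless_poset E ends. H \<subseteq> A}. mobius (bridgeless_poset E ends) {} H)
    = (if forest ends A then 1 else 0)"
proof -
  let ?P = "bridgeless_poset E ends"
  \<comment> \<open>The largest bridgeless subset of \<open>A\<close>. It turns the sum over all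
    poset elements inside \<open>A\<close> into a sum over the interval from \<open>{}\<close> to
    \<open>M\<close>.\<close>
  define M where "M = \<Union>{H\<in>?P. H \<subseteq> A}"
  have M: "M \<in> ?P" using bridgeless_Union[of "{H\<in>?P. H \<subseteq> A}" ends]
    by (auto simp: M_def bridgeless_poset_def)
  have "{H\<in>?P. H \<subseteq> A} = {r\<in>?P. {} \<subseteq> r \<and> r \<subseteq> M}" unfolding M_def by auto
  moreover have "forest ends A \<longleftrightarrow> {} = M"
    using assms unfolding forest_def M_def bridgeless_poset_def by auto
  moreover have "{} \<in> ?P" by (simp add: bridgeless_poset_def)
  ultimately show ?thesis using mobius_sum_interval[of "{}" ?P M] M by simp
qed

lemma smult_sum_right: "smult c (\<Sum>x\<in>A. f x) = (\<Sum>x\<in>A. smult c (f x))"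
  by (induction A rule: infinite_finite_induct) (simp_all add: smult_add_right)

lemma mobius_expansion:
  fixes E :: "'e::finite set" and ends :: "'e \<Rightarrow> 'v \<times> 'v"
  shows "(\<Sum>H\<in>bridgeless_poset E ends. smult (mobius (bridgeless_poset E ends) {} H)
          ([:0, 2:] ^ card H * [:1, 3:] ^ (card E - card H))) = forest_poly E ends"
proof -
  let ?P = "bridgeless_poset E ends" and ?a = "[:0, 2:] :: int poly" and ?b = "[:1, 1:] :: int poly"
  let ?m = "mobius ?P {}"
  have PE: "H \<subseteq> E" if "H \<in> ?P" for H using that by (simp add: bridgeless_poset_def)
  have exp: "?a ^ card H * [:1, 3:] ^ (card E - card H)
     = (\<Sum>A\<in>{A. H \<subseteq> A \<and> A \<subseteq> E}. ?a ^ card A * ?b ^ (card E - card A))" if H: "H \<subseteq> E" for H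
  proof -
    \<comment> \<open>Each edge outside \<open>H\<close> chooses 2z or 1+z. \<open>J\<close>
      collects those that choose 2z, and \<open>A\<close> below is the union of \<open>H\<close> and
      \<open>J\<close>.\<close>
    have "[:1, 3:] ^ (card E - card H) = (\<Prod>e\<in>E - H. ?a + ?b)"
      using H by (simp add: card_Diff_subset)
    also have "\<dots> = (\<Sum>J\<in>Pow (E - H). ?a ^ card J * ?b ^ card (E - H - J))"
      by (subst prod_add) auto
    finally have "?a ^ card H * [:1, 3:] ^ (card E - card H)
       = (\<Sum>J\<in>Pow (E - H). ?a ^ card H * (?a ^ card J * ?b ^ card (E - H - J)))"
      by (simp add: sum_distrib_left del: mult_pCons_left mult_pCons_right)
    also have "\<dots> = (\<Sum>A\<in>{A. H \<subseteq> A \<and> A \<subseteq> E}. ?a ^ card A * ?b ^ (card E - card A))"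
    proof (rule sum.reindex_bij_witness[where i = "\<lambda>A. A - H" and j = "\<lambda>J. H \<union> J"])
      fix J assume J: "J \<in> Pow (E - H)"
      then have "card (H \<union> J) = card H + card J" by (intro card_Un_disjoint) auto
      moreover have "E - H - J = E - (H \<union> J)" by auto
      moreover have "card (E - (H \<union> J)) = card E - card (H \<union> J)"
        using J H by (intro card_Diff_subset) auto
      ultimately show "?a ^ card (H \<union> J) * ?b ^ (card E - card (H \<union> J))
        = ?a ^ card H * (?a ^ card J * ?b ^ card (E - H - J))"
        by (simp add: power_add mult.assoc del: mult_pCons_left mult_pCons_right)
    qed (use H in auto)
    finally show ?thesis .
  qed
  have "(\<Sum>H\<in>?P. smult (?m H) (?a ^ card H * [:1, 3:] ^ (card E - card H)))
    = (\<Sum>H\<in>?P. \<Sum>A\<in>{A. A \<in> Pow E \<and> H \<subseteq> A}. smult (?m H) (?a ^ card A * ?b ^ (card E - card A)))"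
    proof (intro sum.cong refl)
    fix H assume "H \<in> ?P"
    then have "?a ^ card H * [:1, 3:] ^ (card E - card H)
      = (\<Sum>A\<in>{A. A \<in> Pow E \<and> H \<subseteq> A}. ?a ^ card A * ?b ^ (card E - card A))"
      using exp[OF PE] by (simp add: conj_commute)
    then show "smult (?m H) (?a ^ card H * [:1, 3:] ^ (card E - card H))
      = (\<Sum>A\<in>{A. A \<in> Pow E \<and> H \<subseteq> A}. smult (?m H) (?a ^ card A * ?b ^ (card E - card A)))"
      by (simp only: smult_sum_right)
  qed
  \<comment> \<open>After the exchange, the coefficient of the term of \<open>A\<close> is the sum
    of the Moebius function over the poset elements inside \<open>A\<close>.\<close>
  also have "\<dots> = (\<Sum>A\<in>Pow E. \<Sum>H\<in>{H. H \<in> ?P \<and> H \<subseteq> A}. smult (?m H) (?a ^ card A * ?b ^ (card E - card A)))"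
    by (rule sum.swap_restrict) auto
  also have "\<dots> = (\<Sum>A\<in>Pow E. if forest ends A then ?a ^ card A * ?b ^ (card E - card A) else 0)"
  proof (intro sum.cong refl)
    fix A assume "A \<in> Pow E"
    then have "(\<Sum>H\<in>{H. H \<in> ?P \<and> H \<subseteq> A}. ?m H) = (if forest ends A then 1 else 0)"
      using sum_mobius_bridgeless[of A E ends] by simp
    then show "(\<Sum>H\<in>{H. H \<in> ?P \<and> H \<subseteq> A}. smult (?m H) (?a ^ card A * ?b ^ (card E - card A)))
       = (if forest ends A then ?a ^ card A * ?b ^ (card E - card A) else 0)"
      unfolding smult_sum[symmetric] by simp
  qed
  also have "\<dots> = forest_poly E ends"
    unfolding forest_poly_def forests_def
    by (simp add: sum.inter_filter[symmetric])
  finally show ?thesis .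
qed

section \<open>The cut description of the cone and its fibres along an edge\<close>

text \<open>Nonnegativity for all \<open>S\<close> is Gale's feasibility condition: a flow with
  capacity \<open>max 0 (y e)\<close> in either direction on each edge can make \<open>x\<close>
  nonnegative.\<close>

definition cutval :: "('e::finite \<Rightarrow> 'v::finite \<times> 'v) \<Rightarrow> 'e set \<Rightarrow> ('v \<Rightarrow> int) \<Rightarrow> ('e \<Rightarrow> int) \<Rightarrow> 'v set \<Rightarrow> int" where
  "cutval ends E x y S = sum x S +
     (\<Sum>e\<in>E. if (fst (ends e) \<in> S) = (snd (ends e) \<in> S) then 0 else max 0 (y e))"

definition shift :: "'v \<Rightarrow> 'v \<Rightarrow> int \<Rightarrow> ('v \<Rightarrow> int) \<Rightarrow> 'v \<Rightarrow> int" where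
  "shift u v i x = (\<lambda>a. x a + i * (of_bool (a = u) - of_bool (a = v)))"

text \<open>The projection along e_u - e_v for distinct \<open>u\<close>, \<open>v\<close>, with
  \<open>v\<close> set to 0 to choose coordinates on the quotient. Its fibres are the lines along
  which \<open>shift\<close> moves.\<close>

definition vmerge :: "'v \<Rightarrow> 'v \<Rightarrow> ('v \<Rightarrow> int) \<Rightarrow> 'v \<Rightarrow> int" where
  "vmerge u v x = (\<lambda>a. if a = v then 0 else if a = u then x u + x v else x a)"

definition cone_points ::
  "'v::finite set \<Rightarrow> 'e::finite set \<Rightarrow> ('e \<Rightarrow> 'v \<times> 'v) \<Rightarrow> nat \<Rightarrow> (('v \<Rightarrow> int) \<times> ('e \<Rightarrow> int)) set" where
  "cone_points V E ends j = {(x, y). (\<forall>a. a \<notin> V \<longrightarrow> x a = 0) \<and> (\<forall>e. e \<notin> E \<longrightarrow> y e = 0) \<and>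
     (\<forall>S. 0 \<le> cutval ends E x y S) \<and> sum x UNIV + (\<Sum>e\<in>UNIV. \<bar>y e\<bar>) = int j}"

text \<open>With \<open>w = max 0 t\<close> this describes the slice \<open>y f = t\<close> of the
  cone for \<open>insert f E\<close>, after \<open>y f\<close> has been reset to 0 and its
  contribution taken off the degree.\<close>

definition slab ::
  "'v::finite set \<Rightarrow> 'e::finite set \<Rightarrow> ('e \<Rightarrow> 'v \<times> 'v) \<Rightarrow> 'v \<Rightarrow> 'v \<Rightarrow> int \<Rightarrow> nat \<Rightarrow> (('v \<Rightarrow> int) \<times> ('e \<Rightarrow> int)) set" where
  "slab V E ends u v w j = {(x, y). (\<forall>a. a \<notin> V \<longrightarrow> x a = 0) \<and> (\<forall>e. e \<notin> E \<longrightarrow> y e = 0) \<and>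
     (\<exists>i. \<bar>i\<bar> \<le> w \<and> (\<forall>S. 0 \<le> cutval ends E (shift u v i x) y S)) \<and> sum x UNIV + (\<Sum>e\<in>UNIV. \<bar>y e\<bar>) = int j}"

lemma sum_shift:
  fixes S :: "'v::finite set"
  shows "sum (shift u v i x) S = sum x S + i * (of_bool (u \<in> S) - of_bool (v \<in> S))"
proof -
  have "(\<Sum>a\<in>S. of_bool (a = w) :: int) = of_bool (w \<in> S)" for w
    by (simp add: of_bool_def)
  then show ?thesis
    by (simp add: shift_def sum.distrib sum_subtractf flip: sum_distrib_left)
qed

lemma cutval_shift:
  "cutval ends E (shift u v i x) y S = cutval ends E x y S + i * (of_bool (u \<in> S) - of_bool (v \<in> S))"
  by (simp add: cutval_def sum_shift)

lemma shift_shift: "shift u v i (shift u v k x) = shift u v (i + k) x"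
  by (auto simp: shift_def algebra_simps)

lemma shift_0 [simp]: "shift u v 0 x = x"
  by (simp add: shift_def)

text \<open>The vertex part is modular, and each edge part is a cut function with weight
  \<open>max 0 (y e)\<close>. Truncation at 0 matters, since a negative weight would reverse the
  inequality.\<close>

lemma cutval_submodular:
  "cutval ends E x y (S \<union> T) + cutval ends E x y (S \<inter> T) \<le> cutval ends E x y S + cutval ends E x y T"
proof -
  let ?c = "\<lambda>S e. if (fst (ends e) \<in> S) = (snd (ends e) \<in> S) then 0 else max 0 (y e)"
  have "(\<Sum>e\<in>E. ?c (S \<union> T) e) + (\<Sum>e\<in>E. ?c (S \<inter> T) e) \<le> (\<Sum>e\<in>E. ?c S e) + (\<Sum>e\<in>E. ?c T e)"
    unfolding sum.distrib[symmetric] by (rule sum_mono) auto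
  then show ?thesis
    using sum.union_inter[of S T x] unfolding cutval_def by simp
qed

text \<open>The existence of an integral shift. Only sets separating \<open>u\<close> from
  \<open>v\<close> constrain \<open>i\<close>: those with \<open>u\<close> from below, those with
  \<open>v\<close> from above.\<close>

lemma exists_shift:
  assumes lohi: "lo \<le> hi"
    and neutral: "\<And>S. (u \<in> S) = (v \<in> S) \<Longrightarrow> 0 \<le> cutval ends E x y S"
    and upper: "\<And>S. u \<in> S \<Longrightarrow> v \<notin> S \<Longrightarrow> - cutval ends E x y S \<le> hi"
    and lower: "\<And>S. v \<in> S \<Longrightarrow> u \<notin> S \<Longrightarrow> lo \<le> cutval ends E x y S"
  shows "\<exists>i\<ge>lo. i \<le> hi \<and> (\<forall>S. 0 \<le> cutval ends E (shift u v i x) y S)"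
proof -
  let ?B = "insert lo ((\<lambda>S. - cutval ends E x y S) ` {S. u \<in> S \<and> v \<notin> S})"
  \<comment> \<open>The smallest shift meeting all lower bounds. Including \<open>lo\<close> keeps
    the set nonempty and gives the required lower limit.\<close>
  define i where "i = Max ?B"
  have fin: "finite ?B" by simp
  have ge: "b \<le> i" if "b \<in> ?B" for b unfolding i_def using fin that by (rule Max_ge)
  have le: "i \<le> c" if "\<And>b. b \<in> ?B \<Longrightarrow> b \<le> c" for c
    unfolding i_def using that by (intro Max.boundedI) auto
  have "0 \<le> cutval ends E (shift u v i x) y S" for S
  proof -
    consider "(u \<in> S) = (v \<in> S)" | "u \<in> S" "v \<notin> S" | "v \<in> S" "u \<notin> S" by blast
    then show ?thesis
    proof cases
      case 1
      then show ?thesis using neutral by (simp add: cutval_shift)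
    next
      case 2
      then have "- cutval ends E x y S \<le> i" by (intro ge) auto
      then show ?thesis using 2 by (simp add: cutval_shift)
    next
      case 3
      \<comment> \<open>The union of \<open>S\<close> and \<open>T\<close> contains both
        \<open>u\<close> and \<open>v\<close> and the intersection contains neither, so both have
        nonnegative value and submodularity compares the two bounds.\<close>
      have "- cutval ends E x y T \<le> cutval ends E x y S" if "u \<in> T" "v \<notin> T" for T
        using cutval_submodular[of ends E x y S T] neutral[of "S \<union> T"] neutral[of "S \<inter> T"] that 3 by auto
      then have "i \<le> cutval ends E x y S" using 3 lower by (intro le) auto
      then show ?thesis using 3 by (simp add: cutval_shift)
    qed
  qed
  moreover have "lo \<le> i" by (intro ge) auto
  moreover have "i \<le> hi" using lohi upper by (intro le) auto
  ultimately show ?thesis by blast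
qed

lemma cutval_insert:
  assumes "f \<notin> E" "ends f = (u, v)"
  shows "cutval ends (insert f E) x y S = cutval ends E x y S + (if (u \<in> S) = (v \<in> S) then 0 else max 0 (y f))"
  using assms by (simp add: cutval_def)

text \<open>The new edge adds \<open>max 0 (y f)\<close> exactly to the separating cuts, and a shift
  of at most that size can make up for it. Applied edge by edge, this builds the integral
  flow.\<close>

lemma cut_insert_iff:
  assumes f: "f \<notin> E" "ends f = (u, v)"
  shows "(\<forall>S. 0 \<le> cutval ends (insert f E) x y S) \<longleftrightarrow>
    (\<exists>i. \<bar>i\<bar> \<le> max 0 (y f) \<and> (\<forall>S. 0 \<le> cutval ends E (shift u v i x) y S))"
proof
  assume *: "\<forall>S. 0 \<le> cutval ends (insert f E) x y S"
  have "\<exists>i\<ge>- max 0 (y f). i \<le> max 0 (y f) \<and> (\<forall>S. 0 \<le> cutval ends E (shift u v i x) y S)"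
  proof (rule exists_shift)
    fix S
    show "(u \<in> S) = (v \<in> S) \<Longrightarrow> 0 \<le> cutval ends E x y S"
      "u \<in> S \<Longrightarrow> v \<notin> S \<Longrightarrow> - cutval ends E x y S \<le> max 0 (y f)"
      "v \<in> S \<Longrightarrow> u \<notin> S \<Longrightarrow> - max 0 (y f) \<le> cutval ends E x y S"
      using *[rule_format, of S] unfolding cutval_insert[of f E ends u v, OF f] by simp_all
  qed simp
  then show "\<exists>i. \<bar>i\<bar> \<le> max 0 (y f) \<and> (\<forall>S. 0 \<le> cutval ends E (shift u v i x) y S)"
    by (auto intro!: abs_leI simp del: max.bounded_iff)
next
  assume "\<exists>i. \<bar>i\<bar> \<le> max 0 (y f) \<and> (\<forall>S. 0 \<le> cutval ends E (shift u v i x) y S)"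
  then obtain i where i: "\<bar>i\<bar> \<le> max 0 (y f)" "\<And>S. 0 \<le> cutval ends E (shift u v i x) y S" by blast
  show "\<forall>S. 0 \<le> cutval ends (insert f E) x y S"
  proof
    fix S
    show "0 \<le> cutval ends (insert f E) x y S"
      using i(1) i(2)[of S] unfolding cutval_insert[of f E ends u v, OF f] cutval_shift
      by (cases "u \<in> S"; cases "v \<in> S"; simp)
  qed
qed

section \<open>Contraction as projection along e_u - e_v\<close>

lemma sum_vmerge:
  fixes S :: "'v::finite set"
  assumes "u \<noteq> v"
  shows "sum (vmerge u v x) S = sum x {a. (id(v := u)) a \<in> S}"
proof -
  have "vmerge u v x a = sum x {b \<in> {a. (id(v := u)) a \<in> S}. (id(v := u)) b = a}" if "a \<in> S" for a
  proof -
    have "{b \<in> {a. (id(v := u)) a \<in> S}. (id(v := u)) b = a} = (if a = v then {} else if a = u then {u, v} else {a})"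
      using that assms by auto
    then show ?thesis using assms by (simp add: vmerge_def)
  qed
  then have "sum (vmerge u v x) S = (\<Sum>a\<in>S. sum x {b \<in> {a. (id(v := u)) a \<in> S}. (id(v := u)) b = a})"
    by (rule sum.cong[OF refl])
  also have "\<dots> = sum x {a. (id(v := u)) a \<in> S}"
    by (rule sum.group) auto
  finally show ?thesis .
qed

text \<open>Cuts of the contraction are the cuts of the original graph that do not separate
  \<open>u\<close> from \<open>v\<close>: a set is replaced by its preimage.\<close>

lemma cutval_contract:
  assumes "u \<noteq> v"
  shows "cutval (contract u v ends) E (vmerge u v x) y S = cutval ends E x y {a. (id(v := u)) a \<in> S}"
  unfolding cutval_def sum_vmerge[OF assms] by (simp add: contract_def)

lemma cut_contract_iff:
  assumes uv: "u \<noteq> v"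
  shows "(\<forall>S. 0 \<le> cutval (contract u v ends) E (vmerge u v x) y S) \<longleftrightarrow>
    (\<exists>i. \<forall>S. 0 \<le> cutval ends E (shift u v i x) y S)"
proof
  assume *: "\<forall>S. 0 \<le> cutval (contract u v ends) E (vmerge u v x) y S"
  \<comment> \<open>A bound for all cut values at once, finite because there are finitely many sets;
    shifts up to \<open>B\<close> impose no real restriction.\<close>
  define B where "B = (\<Sum>S\<in>UNIV. \<bar>cutval ends E x y S\<bar>)"
  have B: "\<bar>cutval ends E x y S\<bar> \<le> B" for S
    unfolding B_def by (rule member_le_sum) auto
  have "\<exists>i\<ge>-B. i \<le> B \<and> (\<forall>S. 0 \<le> cutval ends E (shift u v i x) y S)"
  proof (rule exists_shift)
    fix S assume "(u \<in> S) = (v \<in> S)"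
    then have "{a. (id(v := u)) a \<in> S} = S" by auto
    then show "0 \<le> cutval ends E x y S" using *[rule_format, of S] cutval_contract[OF uv, of ends E x y S] by metis
  next
    show "- B \<le> B" using B[of "{}"] by linarith
  qed (use B in \<open>simp_all add: abs_le_iff minus_le_iff\<close>)
  then show "\<exists>i. \<forall>S. 0 \<le> cutval ends E (shift u v i x) y S" by blast
next
  assume "\<exists>i. \<forall>S. 0 \<le> cutval ends E (shift u v i x) y S"
  then obtain i where i: "\<And>S. 0 \<le> cutval ends E (shift u v i x) y S" by blast
  have "(u \<in> {a. (id(v := u)) a \<in> S}) = (v \<in> {a. (id(v := u)) a \<in> S})" for S by simp
  then show "\<forall>S. 0 \<le> cutval (contract u v ends) E (vmerge u v x) y S"
    using i[of "{a. (id(v := u)) a \<in> _}"] unfolding cutval_shift cutval_contract[OF uv] by simp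
qed

section \<open>Finiteness, and the count of a thickened set\<close>

lemma finite_bounded_funs:
  fixes T :: "'b set"
  assumes "finite T"
  shows "finite {f :: 'a::finite \<Rightarrow> 'b. \<forall>a. f a \<in> T}"
proof -
  have "{f :: 'a \<Rightarrow> 'b. \<forall>a. f a \<in> T} = PiE UNIV (\<lambda>_. T)" by (auto simp: PiE_def)
  then show ?thesis using assms by (simp add: finite_PiE)
qed

lemma finite_cone_points: "finite (cone_points V E ends j)"
proof (rule finite_subset)
  \<comment> \<open>The cut at \<open>UNIV\<close> bounds the sum of all absolute edge values by
    \<open>j\<close>, hence the sum of \<open>x\<close> over any set is at least \<open>-j\<close>.
    As the total is at most \<open>j\<close>, a single coordinate is at most
    \<open>2 * j\<close>.\<close>
  let ?T = "{- int j..2 * int j}"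
  show "cone_points V E ends j \<subseteq> {x. \<forall>a. x a \<in> ?T} \<times> {y. \<forall>e. y e \<in> ?T}"
  proof clarify
    fix x y assume "(x, y) \<in> cone_points V E ends j"
    then have cut: "\<And>S. 0 \<le> cutval ends E x y S" and deg: "sum x UNIV + (\<Sum>e\<in>UNIV. \<bar>y e\<bar>) = int j"
      by (auto simp: cone_points_def)
    have ys: "(\<Sum>e\<in>UNIV. \<bar>y e\<bar>) \<le> int j" using cut[of UNIV] deg by (simp add: cutval_def)
    have edges: "(\<Sum>e\<in>E. if (fst (ends e) \<in> S) = (snd (ends e) \<in> S) then 0 else max 0 (y e)) \<le> int j" for S
    proof -
      have "(\<Sum>e\<in>E. if (fst (ends e) \<in> S) = (snd (ends e) \<in> S) then 0 else max 0 (y e)) \<le> (\<Sum>e\<in>E. \<bar>y e\<bar>)"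
        by (rule sum_mono) auto
      also have "\<dots> \<le> (\<Sum>e\<in>UNIV. \<bar>y e\<bar>)" by (rule sum_mono2) auto
      finally show ?thesis using ys by linarith
    qed
    have xs: "- int j \<le> sum x S" for S using cut[of S] edges[of S] by (simp add: cutval_def)
    have "sum x UNIV \<le> int j" using deg sum_nonneg[of UNIV "\<lambda>e. \<bar>y e\<bar>"] by linarith
    moreover have "sum x UNIV = x a + sum x (UNIV - {a})" for a by (simp add: sum.remove)
    ultimately have "x a \<le> 2 * int j" for a using xs[of "UNIV - {a}"] by (smt (verit))
    moreover have "- int j \<le> x a" for a using xs[of "{a}"] by simp
    ultimately have "x a \<in> ?T" for a by simp
    moreover have "\<bar>y e\<bar> \<le> int j" for e
      using member_le_sum[of e UNIV "\<lambda>e. \<bar>y e\<bar>"] ys by simp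
    then have "y e \<in> ?T" for e using abs_le_D1 abs_le_D2 by (smt (verit) atLeastAtMost_iff)
    ultimately show "x \<in> {x. \<forall>a. x a \<in> ?T} \<and> y \<in> {y. \<forall>e. y e \<in> ?T}" by simp
  qed
  show "finite ({x :: 'a \<Rightarrow> int. \<forall>a. x a \<in> ?T} \<times> {y :: 'b \<Rightarrow> int. \<forall>e. y e \<in> ?T})"
    by (intro finite_cartesian_product finite_bounded_funs) auto
qed

text \<open>Every nonempty fibre is an integer interval, so thickening lengthens it by
  \<open>2 * w\<close>; the number of such fibres is the size of the projection.\<close>

lemma card_thicken_fibres:
  fixes A :: "('a \<times> int) set"
  assumes fin: "finite A" and w: "w \<ge> 0"
    and interval: "\<And>p s t r. (p, s) \<in> A \<Longrightarrow> (p, t) \<in> A \<Longrightarrow> s \<le> r \<Longrightarrow> r \<le> t \<Longrightarrow> (p, r) \<in> A"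
  shows "int (card {(p, t). \<exists>i. \<bar>i\<bar> \<le> w \<and> (p, t - i) \<in> A}) = int (card A) + 2 * w * int (card (fst ` A))"
proof -
  define F where "F p = {t. (p, t) \<in> A}" for p
  define lo hi where "lo p = Min (F p)" and "hi p = Max (F p)" for p
  have finF: "finite (F p)" for p
    using finite_vimageI[OF fin, of "Pair p"] by (simp add: F_def vimage_def inj_on_def)
  have F: "F p = {lo p..hi p} \<and> lo p \<le> hi p" if "p \<in> fst ` A" for p
  proof -
    have ne: "F p \<noteq> {}" using that by (force simp: F_def)
    have mem: "lo p \<in> F p" "hi p \<in> F p" using finF ne by (auto simp: lo_def hi_def)
    have bounds: "lo p \<le> t \<and> t \<le> hi p" if "t \<in> F p" for t using finF that by (auto simp: lo_def hi_def)
    have between: "t \<in> F p" if "lo p \<le> t" "t \<le> hi p" for t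
      using interval[of p "lo p" "hi p" t] that mem by (simp add: F_def)
    have "F p = {lo p..hi p}"
    proof (intro set_eqI iffI)
      fix t assume "t \<in> F p" then show "t \<in> {lo p..hi p}" using bounds by simp
    next
      fix t assume "t \<in> {lo p..hi p}" then show "t \<in> F p" using between by simp
    qed
    then show ?thesis using bounds[OF mem(1)] by simp
  qed
  have memA: "(p, t) \<in> A \<longleftrightarrow> p \<in> fst ` A \<and> t \<in> {lo p..hi p}" for p t
  proof -
    have "(p, t) \<in> A \<longleftrightarrow> p \<in> fst ` A \<and> t \<in> F p" by (force simp: F_def)
    then show ?thesis using F[of p] by metis
  qed
  define P where "P = fst ` A"
  have finP: "finite P" and P: "\<And>p. p \<in> P \<Longrightarrow> lo p \<le> hi p"
    using fin F by (simp_all add: P_def)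
  have A: "A = Sigma P (\<lambda>p. {lo p..hi p})"
    using memA unfolding P_def[symmetric] by (intro set_eqI) (simp only: split_paired_all mem_Sigma_iff)
  have clamp: "(\<exists>i. \<bar>i\<bar> \<le> w \<and> t - i \<in> {lo p..hi p}) \<longleftrightarrow> t \<in> {lo p - w..hi p + w}" if "p \<in> P" for p t
  proof
    assume "t \<in> {lo p - w..hi p + w}"
    \<comment> \<open>The witness is the signed distance from \<open>t\<close> to the nearest point
      of the interval.\<close>
    then show "\<exists>i. \<bar>i\<bar> \<le> w \<and> t - i \<in> {lo p..hi p}"
      using P[OF that] w
      by (intro exI[of _ "if t < lo p then t - lo p else if hi p < t then t - hi p else 0"]) auto
  qed auto
  have B: "{(p, t). \<exists>i. \<bar>i\<bar> \<le> w \<and> (p, t - i) \<in> A} = Sigma P (\<lambda>p. {lo p - w..hi p + w})"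
  proof (rule set_eqI)
    fix z :: "'a \<times> int"
    obtain p t where z: "z = (p, t)" by force
    have "(\<exists>i. \<bar>i\<bar> \<le> w \<and> (p, t - i) \<in> A) \<longleftrightarrow> p \<in> P \<and> (\<exists>i. \<bar>i\<bar> \<le> w \<and> t - i \<in> {lo p..hi p})"
      unfolding memA P_def[symmetric] by blast
    then show "z \<in> {(p, t). \<exists>i. \<bar>i\<bar> \<le> w \<and> (p, t - i) \<in> A} \<longleftrightarrow> z \<in> Sigma P (\<lambda>p. {lo p - w..hi p + w})"
      unfolding z mem_Collect_eq prod.case mem_Sigma_iff using clamp by metis
  qed
  have "int (card (Sigma P (\<lambda>p. {lo p..hi p}))) = (\<Sum>p\<in>P. hi p - lo p + 1)"
    using finP P by (simp add: card_SigmaI)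
  moreover have "int (card (Sigma P (\<lambda>p. {lo p - w..hi p + w}))) = (\<Sum>p\<in>P. (hi p - lo p + 1) + 2 * w)"
  proof -
    have "int (nat (hi p + w - (lo p - w) + 1)) = (hi p - lo p + 1) + 2 * w" if "p \<in> P" for p
      using P[OF that] w by simp
    then show ?thesis using finP by (simp add: card_SigmaI)
  qed
  ultimately show ?thesis unfolding B P_def[symmetric] A[symmetric] by (simp add: sum.distrib)
qed

lemma slab_loop: "w \<ge> 0 \<Longrightarrow> slab V E ends u u w j = cone_points V E ends j"
  by (auto simp: slab_def cone_points_def shift_def intro!: exI[of _ 0])

lemma vmerge_shift: "u \<noteq> v \<Longrightarrow> vmerge u v (shift u v i x) = vmerge u v x"
  by (auto simp: vmerge_def shift_def)

lemma shift_mem_cone_points: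
  assumes "u \<in> V" "v \<in> V"
  shows "(shift u v i x, y) \<in> cone_points V E ends j \<longleftrightarrow>
    (\<forall>a. a \<notin> V \<longrightarrow> x a = 0) \<and> (\<forall>e. e \<notin> E \<longrightarrow> y e = 0) \<and>
    (\<forall>S. 0 \<le> cutval ends E (shift u v i x) y S) \<and> sum x UNIV + (\<Sum>e\<in>UNIV. \<bar>y e\<bar>) = int j"
proof -
  have "a \<notin> V \<Longrightarrow> shift u v i x a = x a" for a using assms by (auto simp: shift_def)
  then show ?thesis by (simp add: cone_points_def sum_shift cong: imp_cong)
qed

text \<open>\<open>Phi\<close> splits a point into its class modulo e_u - e_v and the position
  \<open>x v\<close> on that line; a shift by \<open>i\<close> lowers the position by
  \<open>i\<close>. The projection to classes yields the cone points of the contraction.\<close>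

lemma card_slab:
  fixes ends :: "'e::finite \<Rightarrow> 'v::finite \<times> 'v"
  assumes uv: "u \<noteq> v" "u \<in> V" "v \<in> V" and w: "w \<ge> 0"
  shows "int (card (slab V E ends u v w j)) = int (card (cone_points V E ends j))
    + 2 * w * int (card (cone_points (V - {v}) E (contract u v ends) j))"
proof -
  define Phi :: "('v \<Rightarrow> int) \<times> ('e \<Rightarrow> int) \<Rightarrow> (('v \<Rightarrow> int) \<times> ('e \<Rightarrow> int)) \<times> int"
    where "Phi = (\<lambda>(x, y). ((vmerge u v x, y), x v))"
  let ?A = "Phi ` cone_points V E ends j"
  have inj: "inj Phi"
  proof (rule injI)
    fix p q :: "('v \<Rightarrow> int) \<times> ('e \<Rightarrow> int)"
    assume eq: "Phi p = Phi q"
    obtain x y x' y' where pq: "p = (x, y)" "q = (x', y')" by (cases p, cases q)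
    then have m: "vmerge u v x = vmerge u v x'" and v: "x v = x' v" and y: "y = y'" using eq by (auto simp: Phi_def)
    have "x a = x' a" for a using fun_cong[OF m, of a] v uv by (auto simp: vmerge_def split: if_splits)
    then show "p = q" using pq y by auto
  qed
  have Phi_shift: "Phi (shift u v i x, y) = (p, t - i) \<longleftrightarrow> Phi (x, y) = (p, t)" for i x y p t
  proof -
    have "shift u v i x v = x v - i" using uv by (simp add: shift_def)
    then show ?thesis using uv by (auto simp: Phi_def vmerge_shift)
  qed
  have mem: "(p, t - i) \<in> ?A \<longleftrightarrow> (\<exists>x y. Phi (x, y) = (p, t) \<and> (shift u v i x, y) \<in> cone_points V E ends j)" for p t i
  proof
    assume "(p, t - i) \<in> ?A"
    then obtain x y where xy: "Phi (x, y) = (p, t - i)" "(x, y) \<in> cone_points V E ends j" by auto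
    have x: "shift u v i (shift u v (- i) x) = x" by (simp add: shift_shift)
    then have "Phi (shift u v (- i) x, y) = (p, t)" using xy(1) Phi_shift[of i "shift u v (- i) x" y p t] by simp
    then show "\<exists>x y. Phi (x, y) = (p, t) \<and> (shift u v i x, y) \<in> cone_points V E ends j"
      using xy(2) x by metis
  next
    assume "\<exists>x y. Phi (x, y) = (p, t) \<and> (shift u v i x, y) \<in> cone_points V E ends j"
    then show "(p, t - i) \<in> ?A" using Phi_shift by (metis imageI)
  qed
  have interval: "(p, r) \<in> ?A" if s: "(p, s) \<in> ?A" and t: "(p, t) \<in> ?A" and "s \<le> r" "r \<le> t" for p s t r
  proof -
    have rs: "r - (r - s) = s" and rt: "r - (r - t) = t" by auto
    obtain x y where xy: "Phi (x, y) = (p, r)" "(shift u v (r - s) x, y) \<in> cone_points V E ends j"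
      using s unfolding mem[of p r "r - s", unfolded rs] by blast
    obtain x' y' where xy': "Phi (x', y') = (p, r)" "(shift u v (r - t) x', y') \<in> cone_points V E ends j"
      using t unfolding mem[of p r "r - t", unfolded rt] by blast
    have "(x', y') = (x, y)" using xy(1) xy'(1) inj by (metis injD)
    then have c: "0 \<le> cutval ends E (shift u v (r - s) x) y S" "0 \<le> cutval ends E (shift u v (r - t) x) y S" for S
      using xy(2) xy'(2) by (auto simp: cone_points_def)
    \<comment> \<open>Cut values are affine in the shift, and 0 lies between the two shifts
      \<open>r - t\<close> and \<open>r - s\<close>.\<close>
    have "0 \<le> cutval ends E x y S" for S
      using c[of S] that(3,4) unfolding cutval_shift by (cases "u \<in> S"; cases "v \<in> S"; simp)
    then have "(shift u v 0 x, y) \<in> cone_points V E ends j"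
      using xy(2) unfolding shift_mem_cone_points[OF uv(2,3)] by simp
    then show ?thesis using xy(1) by (metis imageI shift_0)
  qed
  have slab: "Phi ` slab V E ends u v w j = {(p, t). \<exists>i. \<bar>i\<bar> \<le> w \<and> (p, t - i) \<in> ?A}"
  proof -
    have "(x, y) \<in> slab V E ends u v w j \<longleftrightarrow> (\<exists>i. \<bar>i\<bar> \<le> w \<and> (shift u v i x, y) \<in> cone_points V E ends j)" for x y
      unfolding shift_mem_cone_points[OF uv(2,3)] slab_def by auto
    then show ?thesis unfolding mem by (auto simp: image_iff) metis+
  qed
  have proj: "fst ` ?A = cone_points (V - {v}) E (contract u v ends) j"
  proof -
    have key: "(\<exists>i. (shift u v i x, y) \<in> cone_points V E ends j) \<longleftrightarrow>
      (vmerge u v x, y) \<in> cone_points (V - {v}) E (contract u v ends) j" if "\<forall>a. a \<notin> V \<longrightarrow> x a = 0" for x y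
    proof -
      have "sum (vmerge u v x) UNIV = sum x UNIV" using sum_vmerge[OF uv(1)] by simp
      moreover have "\<forall>a. a \<notin> V - {v} \<longrightarrow> vmerge u v x a = 0" using that uv by (auto simp: vmerge_def)
      ultimately show ?thesis
        using that cut_contract_iff[OF uv(1), of ends E x y] unfolding shift_mem_cone_points[OF uv(2,3)]
        by (auto simp: cone_points_def)
    qed
    show ?thesis
    proof (intro equalityI subsetI)
      fix z assume "z \<in> fst ` ?A"
      then obtain x y where xy: "(x, y) \<in> cone_points V E ends j" and z: "z = fst (Phi (x, y))" by auto
      then have "\<forall>a. a \<notin> V \<longrightarrow> x a = 0" by (auto simp: cone_points_def)
      then have "(vmerge u v x, y) \<in> cone_points (V - {v}) E (contract u v ends) j"
        using key[of x y] xy by (metis shift_0)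
      then show "z \<in> cone_points (V - {v}) E (contract u v ends) j"
        using z by (simp add: Phi_def)
    next
      fix z assume z: "z \<in> cone_points (V - {v}) E (contract u v ends) j"
      obtain x y where zxy: "z = (x, y)" by force
      with z have xy: "(x, y) \<in> cone_points (V - {v}) E (contract u v ends) j" by simp
      then have supp: "\<forall>a. a \<notin> V - {v} \<longrightarrow> x a = 0" by (auto simp: cone_points_def)
      \<comment> \<open>A point of the contracted cone already has coordinate 0 at \<open>v\<close>,
        so it is its own merge, and some shift of it lies in the original cone.\<close>
      then have mx: "vmerge u v x = x" by (auto simp: vmerge_def)
      then obtain i where i: "(shift u v i x, y) \<in> cone_points V E ends j"
        using key[of x y] xy supp by auto
      have "fst (Phi (shift u v i x, y)) = (x, y)" using mx uv by (simp add: Phi_def vmerge_shift)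
      then show "z \<in> fst ` ?A" using i unfolding zxy by (metis imageI)
    qed
  qed
  have "card (slab V E ends u v w j) = card (Phi ` slab V E ends u v w j)"
    "card (cone_points V E ends j) = card ?A"
    using inj by (simp_all add: card_image inj_on_subset[OF inj])
  then show ?thesis
    using card_thicken_fibres[OF finite_imageI[OF finite_cone_points] w interval] slab proj by simp
qed

section \<open>The Hilbert series of the cone\<close>

text \<open>Slicing by \<open>t = y f\<close>. For \<open>t\<close> at most 0 the width is 0 and the
  slice is a copy of the cone points without \<open>f\<close>.\<close>

lemma cone_points_insert:
  assumes f: "f \<notin> E" "ends f = (u, v)"
  shows "cone_points V (insert f E) ends j =
    (\<Union>t\<in>{- int j..int j}. (\<lambda>(x, y). (x, y(f := t))) ` slab V E ends u v (max 0 t) (j - nat \<bar>t\<bar>))"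
    (is "_ = (\<Union>t\<in>?T. ?g t ` ?S t)")
proof -
  have cut: "cutval ends E x (y(f := t)) S = cutval ends E x y S" for x y t S
    using f(1) unfolding cutval_def by (intro arg_cong2[where f = plus] sum.cong) auto
  have deg: "(\<Sum>e\<in>UNIV. \<bar>(y(f := t)) e\<bar>) = \<bar>t\<bar> + (\<Sum>e\<in>UNIV - {f}. \<bar>y e\<bar>)" for y :: "_ \<Rightarrow> int" and t
    by (simp add: sum.remove[of UNIV f])
  have key: "(x, y(f := t)) \<in> cone_points V (insert f E) ends j \<longleftrightarrow> \<bar>t\<bar> \<le> int j \<and> (x, y) \<in> ?S t"
    if y: "y f = 0" for x y t
  proof -
    have y0: "y = y(f := 0)" using y by auto
    have "(\<Sum>e\<in>UNIV. \<bar>y e\<bar>) = (\<Sum>e\<in>UNIV - {f}. \<bar>y e\<bar>)" by (subst y0, subst deg) simp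
    then have d: "(\<Sum>e\<in>UNIV. \<bar>(y(f := t)) e\<bar>) = \<bar>t\<bar> + (\<Sum>e\<in>UNIV. \<bar>y e\<bar>)" by (simp only: deg)
    have supp: "(\<forall>e. e \<notin> insert f E \<longrightarrow> (y(f := t)) e = 0) \<longleftrightarrow> (\<forall>e. e \<notin> E \<longrightarrow> y e = 0)"
      using y by auto
    have iff: "(\<forall>S. 0 \<le> cutval ends (insert f E) x (y(f := t)) S) \<longleftrightarrow>
      (\<exists>i. \<bar>i\<bar> \<le> max 0 t \<and> (\<forall>S. 0 \<le> cutval ends E (shift u v i x) y S))"
      unfolding cut_insert_iff[of f E ends u v, OF f] cut by simp
    \<comment> \<open>The cut at \<open>UNIV\<close> makes the total of \<open>x\<close>
      nonnegative, so no slice is lost outside the range and the natural subtraction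
      \<open>j - nat \<bar>t\<bar>\<close> never truncates.\<close>
    have "\<bar>t\<bar> \<le> int j" if "\<forall>S. 0 \<le> cutval ends (insert f E) x (y(f := t)) S"
      "sum x UNIV + (\<bar>t\<bar> + (\<Sum>e\<in>UNIV. \<bar>y e\<bar>)) = int j"
    proof -
      have "0 \<le> sum x UNIV" using that(1)[rule_format, of UNIV] by (simp add: cutval_def)
      moreover have "0 \<le> (\<Sum>e\<in>UNIV. \<bar>y e\<bar>)" by (simp add: sum_nonneg)
      ultimately show ?thesis using that(2) by linarith
    qed
    moreover have "sum x UNIV + (\<bar>t\<bar> + (\<Sum>e\<in>UNIV. \<bar>y e\<bar>)) = int j \<longleftrightarrow>
      sum x UNIV + (\<Sum>e\<in>UNIV. \<bar>y e\<bar>) = int (j - nat \<bar>t\<bar>)" if "\<bar>t\<bar> \<le> int j"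
      using that by (simp add: of_nat_diff) linarith
    ultimately show ?thesis
      unfolding cone_points_def slab_def mem_Collect_eq prod.case supp d iff by blast
  qed
  show ?thesis
  proof (intro equalityI subsetI)
    fix z assume z: "z \<in> cone_points V (insert f E) ends j"
    obtain x y where zxy: "z = (x, y)" by force
    have y: "y = (y(f := 0))(f := y f)" by auto
    have "(x, (y(f := 0))(f := y f)) \<in> cone_points V (insert f E) ends j" using z zxy y by simp
    then have *: "\<bar>y f\<bar> \<le> int j" "(x, y(f := 0)) \<in> ?S (y f)" using key[of "y(f := 0)" x "y f"] by auto
    have "y f \<in> ?T" using *(1) by auto
    moreover have "z \<in> ?g (y f) ` ?S (y f)" using *(2) zxy by (intro rev_image_eqI) auto
    ultimately show "z \<in> (\<Union>t\<in>?T. ?g t ` ?S t)" by blast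
  next
    fix z assume "z \<in> (\<Union>t\<in>?T. ?g t ` ?S t)"
    then obtain t x y where t: "t \<in> ?T" and xy: "(x, y) \<in> ?S t" and z: "z = (x, y(f := t))" by auto
    have "y f = 0" using xy f(1) by (simp add: slab_def)
    moreover have "\<bar>t\<bar> \<le> int j" using t by auto
    ultimately show "z \<in> cone_points V (insert f E) ends j" using key xy z by blast
  qed
qed

lemma card_cone_points_insert:
  assumes f: "f \<notin> E" "ends f = (u, v)"
  shows "card (cone_points V (insert f E) ends j) =
    (\<Sum>t\<in>{- int j..int j}. card (slab V E ends u v (max 0 t) (j - nat \<bar>t\<bar>)))"
proof -
  let ?g = "\<lambda>t (x, y). (x, y(f := t))" and ?S = "\<lambda>t. slab V E ends u v (max 0 t) (j - nat \<bar>t\<bar>)"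
  have y0: "y f = 0" if "(x, y) \<in> ?S t" for x y t using that f(1) by (simp add: slab_def)
  have inj: "inj_on (?g t) (?S t)" for t
  proof (rule inj_onI)
    fix p q assume pq: "p \<in> ?S t" "q \<in> ?S t" "?g t p = ?g t q"
    obtain x y x' y' where p: "p = (x, y)" "q = (x', y')" by (cases p, cases q)
    have "y(f := t) = y'(f := t)" using pq(3) p by simp
    then have "(y(f := t))(f := 0) = (y'(f := t))(f := 0)" by simp
    then have "y = y'" using y0 pq p by (metis fun_upd_idem fun_upd_upd)
    then show "p = q" using pq p by simp
  qed
  have U: "cone_points V (insert f E) ends j = (\<Union>t\<in>{- int j..int j}. ?g t ` ?S t)"
    by (rule cone_points_insert[of f E ends u v, OF f])
  have fin: "finite (?g t ` ?S t)" if "t \<in> {- int j..int j}" for t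
    by (rule finite_subset[OF _ finite_cone_points[of V "insert f E" ends j]]) (use that in \<open>unfold U, blast\<close>)
  have "card (cone_points V (insert f E) ends j) = (\<Sum>t\<in>{- int j..int j}. card (?g t ` ?S t))"
    unfolding U
  proof (rule card_UN_disjoint)
    show "\<forall>t\<in>{- int j..int j}. \<forall>s\<in>{- int j..int j}. t \<noteq> s \<longrightarrow> ?g t ` ?S t \<inter> ?g s ` ?S s = {}"
    proof (intro ballI impI)
      fix t s :: int assume "t \<noteq> s"
      have g: "snd z f = t" if "z \<in> ?g t ` ?S t" for z and t :: int using that by auto
      show "?g t ` ?S t \<inter> ?g s ` ?S s = {}"
      proof (rule equals0I)
        fix z assume "z \<in> ?g t ` ?S t \<inter> ?g s ` ?S s"
        then have "snd z f = t" "snd z f = s" using g by (metis IntD1, metis IntD2)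
        with \<open>t \<noteq> s\<close> show False by simp
      qed
    qed
  qed (use fin in auto)
  also have "\<dots> = (\<Sum>t\<in>{- int j..int j}. card (?S t))" using inj by (simp add: card_image)
  finally show ?thesis .
qed

section \<open>The deletion-contraction recursion and its solution\<close>

lemma sum_symmetric_interval:
  fixes g :: "int \<Rightarrow> 'a::comm_monoid_add"
  shows "(\<Sum>t\<in>{- int j..int j}. g t) = (\<Sum>i=0..j. if i = 0 then g 0 else g (int i) + g (- int i))"
proof (induction j)
  case (Suc j)
  have "{- int (Suc j)..int (Suc j)} = insert (- int (Suc j)) (insert (int (Suc j)) {- int j..int j})" by auto
  then show ?case using Suc by (simp add: ac_simps)
qed simp

definition cone_series :: "'v::finite set \<Rightarrow> 'e::finite set \<Rightarrow> ('e \<Rightarrow> 'v \<times> 'v) \<Rightarrow> int fps" where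
  "cone_series V E ends = Abs_fps (\<lambda>j. int (card (cone_points V E ends j)))"

lemma cone_series_insert:
  assumes f: "f \<notin> E" "ends f = (u, v)" "u \<in> V" "v \<in> V"
  shows "cone_series V (insert f E) ends =
    Abs_fps (\<lambda>i. if i = 0 then 1 else 2) * cone_series V E ends +
    (if u = v then 0 else Abs_fps (\<lambda>i. 2 * int i) * cone_series (V - {v}) E (contract u v ends))"
    (is "_ = ?A * _ + ?R")
proof (rule fps_ext)
  fix j
  let ?c = "\<lambda>k. int (card (cone_points V E ends k))"
  let ?d = "\<lambda>k. if u = v then 0 else int (card (cone_points (V - {v}) E (contract u v ends) k))"
  have slab: "int (card (slab V E ends u v w k)) = ?c k + 2 * w * ?d k" if "w \<ge> 0" for w k
    using that f card_slab[of u v V w E ends k] by (simp add: slab_loop)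
  have "int (card (cone_points V (insert f E) ends j)) =
    (\<Sum>t\<in>{- int j..int j}. ?c (j - nat \<bar>t\<bar>) + 2 * max 0 t * ?d (j - nat \<bar>t\<bar>))"
    unfolding card_cone_points_insert[of f E ends u v, OF f(1,2)] of_nat_sum by (simp only: slab max.cobounded1)
  \<comment> \<open>The values \<open>t = i\<close> and \<open>t = - i\<close> are paired: both
    contribute the deletion count, but only \<open>t = i\<close> is thickened. The value 0 occurs
    once.\<close>
  also have "\<dots> = (\<Sum>i=0..j. (if i = 0 then 1 else 2) * ?c (j - i) + 2 * int i * ?d (j - i))"
    unfolding sum_symmetric_interval by (rule sum.cong) auto
  also have "\<dots> = fps_nth (?A * cone_series V E ends) j + fps_nth ?R j"
    by (simp add: fps_mult_nth cone_series_def sum.distrib)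
  finally show "fps_nth (cone_series V (insert f E) ends) j = fps_nth (?A * cone_series V E ends + ?R) j"
    by (simp add: cone_series_def)
qed

text \<open>Stars and bars by induction on \<open>V\<close>: the coordinate at \<open>b\<close> is
  either 0 or can be lowered by one, so adjoining \<open>b\<close> divides the series by
  \<open>1 - fps_X\<close>.\<close>

lemma orthant_series:
  fixes V :: "'v::finite set"
  shows "Abs_fps (\<lambda>j. int (card {x :: 'v \<Rightarrow> int. (\<forall>a. 0 \<le> x a) \<and> (\<forall>a. a \<notin> V \<longrightarrow> x a = 0) \<and> sum x UNIV = int j}))
    * (1 - fps_X) ^ card V = (1 :: int fps)"
proof -
  define N where "N V j = {x :: 'v \<Rightarrow> int. (\<forall>a. 0 \<le> x a) \<and> (\<forall>a. a \<notin> V \<longrightarrow> x a = 0) \<and> sum x UNIV = int j}" for V j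
  have fin: "finite (N V j)" for V j
  proof (rule finite_subset)
    show "N V j \<subseteq> {x. \<forall>a. x a \<in> {0..int j}}"
    proof clarify
      fix x a assume x: "x \<in> N V j"
      then have "x a \<le> sum x UNIV" by (intro member_le_sum) (auto simp: N_def)
      then show "x a \<in> {0..int j}" using x by (simp add: N_def)
    qed
  qed (rule finite_bounded_funs, simp)
  have "Abs_fps (\<lambda>j. int (card (N V j))) * (1 - fps_X) ^ card V = 1"
  using finite[of V]
  proof (induction V rule: finite_induct)
    case empty
    have "N {} j = (if j = 0 then {\<lambda>_. 0} else {})" for j
      unfolding N_def by (auto simp: fun_eq_iff)
    then show ?case by (auto simp: fps_eq_iff)
  next
    case (insert b V)
    let ?up = "\<lambda>x :: 'v \<Rightarrow> int. x(b := x b + 1)"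
    have sum_up: "sum (x(b := c)) UNIV = sum x UNIV - x b + c" for x :: "'v \<Rightarrow> int" and c
      by (simp add: sum.remove[of UNIV b])
    have zero: "N (insert b V) 0 = N V 0"
    proof -
      have b0: "x b = 0" if "x \<in> N (insert b V) 0" for x
      proof -
        have "x b \<le> sum x UNIV" using that by (intro member_le_sum) (auto simp: N_def)
        then show ?thesis using that by (simp add: N_def order_antisym)
      qed
      then have "x \<in> N V 0" if "x \<in> N (insert b V) 0" for x
      proof -
        have "x a = 0" if "a \<notin> V" for a
          using that \<open>x \<in> _\<close> b0[OF \<open>x \<in> _\<close>] by (cases "a = b") (auto simp: N_def)
        then show ?thesis using that by (simp add: N_def)
      qed
      then show ?thesis by (intro equalityI subsetI) (simp_all add: N_def)
    qed
    have suc: "N (insert b V) (Suc j) = N V (Suc j) \<union> ?up ` N (insert b V) j" for j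
    proof (intro equalityI subsetI)
      fix x assume x: "x \<in> N (insert b V) (Suc j)"
      show "x \<in> N V (Suc j) \<union> ?up ` N (insert b V) j"
      proof (cases "x b = 0")
        case True
        then show ?thesis using x by (auto simp: N_def)
      next
        case False
        have "0 \<le> x b" using x by (simp add: N_def)
        with False have "1 \<le> x b" by simp
        then have "x(b := x b - 1) \<in> N (insert b V) j" using x sum_up[of x "x b - 1"] by (auto simp: N_def)
        moreover have "x = ?up (x(b := x b - 1))" by auto
        ultimately show ?thesis by blast
      qed
    next
      fix x assume "x \<in> N V (Suc j) \<union> ?up ` N (insert b V) j"
      then show "x \<in> N (insert b V) (Suc j)"
      proof
        assume "x \<in> ?up ` N (insert b V) j"
        then obtain x' where x': "x = ?up x'" "x' \<in> N (insert b V) j" by auto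
        then show ?thesis using sum_up[of x' "x' b + 1"] by (simp add: N_def)
      qed (auto simp: N_def)
    qed
    have disj: "N V (Suc j) \<inter> ?up ` N (insert b V) j = {}" for j
    proof -
      have "x b = 0" if "x \<in> N V (Suc j)" for x using that insert.hyps by (auto simp: N_def)
      moreover have "x b \<noteq> 0" if "x \<in> ?up ` N (insert b V) j" for x
      proof -
        obtain x' where x': "x = ?up x'" "x' \<in> N (insert b V) j" using \<open>x \<in> ?up ` _\<close> by auto
        then have "0 \<le> x' b" by (simp add: N_def)
        then show ?thesis using x' by simp
      qed
      ultimately show ?thesis by blast
    qed
    have inj: "inj ?up"
    proof (rule injI)
      fix x y :: "'v \<Rightarrow> int" assume eq: "?up x = ?up y"
      have "x a = y a" for a using fun_cong[OF eq, of a] by (simp split: if_splits)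
      then show "x = y" ..
    qed
    have card: "int (card (N (insert b V) (Suc j))) = int (card (N V (Suc j))) + int (card (N (insert b V) j))" for j
      unfolding suc using card_Un_disjoint[OF fin finite_imageI[OF fin] disj] card_image[OF inj_on_subset[OF inj subset_UNIV]]
      by simp
    have "Abs_fps (\<lambda>j. int (card (N (insert b V) j))) * (1 - fps_X) = Abs_fps (\<lambda>j. int (card (N V j)))"
    proof (rule fps_ext)
      fix j
      show "fps_nth (Abs_fps (\<lambda>j. int (card (N (insert b V) j))) * (1 - fps_X)) j = fps_nth (Abs_fps (\<lambda>j. int (card (N V j)))) j"
        by (cases j) (simp_all add: right_diff_distrib zero card)
    qed
    then have "Abs_fps (\<lambda>j. int (card (N (insert b V) j))) * (1 - fps_X) ^ Suc (card V)
      = Abs_fps (\<lambda>j. int (card (N V j))) * (1 - fps_X) ^ card V"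
      by (simp add: mult.assoc[symmetric])
    then show ?case using insert by simp
  qed
  then show ?thesis by (simp add: N_def)
qed

lemma cone_series_empty:
  fixes V :: "'v::finite set" and ends :: "'e::finite \<Rightarrow> 'v \<times> 'v"
  shows "cone_series V {} ends * (1 - fps_X) ^ card V = 1"
proof -
  let ?N = "\<lambda>j. {x :: 'v \<Rightarrow> int. (\<forall>a. 0 \<le> x a) \<and> (\<forall>a. a \<notin> V \<longrightarrow> x a = 0) \<and> sum x UNIV = int j}"
  have "cone_points V {} ends j = (\<lambda>x. (x, \<lambda>_. 0)) ` ?N j" for j
  proof -
    have "(\<forall>S. 0 \<le> sum x S) \<longleftrightarrow> (\<forall>a. 0 \<le> x a)" for x :: "'v \<Rightarrow> int"
    proof
      assume *: "\<forall>S. 0 \<le> sum x S"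
      show "\<forall>a. 0 \<le> x a"
      proof
        fix a show "0 \<le> x a" using *[rule_format, of "{a}"] by simp
      qed
    qed (simp add: sum_nonneg)
    then show ?thesis by (auto simp: cone_points_def cutval_def fun_eq_iff image_iff)
  qed
  then have "card (cone_points V {} ends j) = card (?N j)" for j
    by (simp add: card_image inj_on_def)
  then show ?thesis using orthant_series[of V] by (simp add: cone_series_def)
qed

text \<open>Deletion loses an edge and leaves one factor \<open>1 - fps_X\<close>; contraction also
  loses a node and leaves two. These clear the denominators of the recursion. The induction varies
  \<open>V\<close> and \<open>ends\<close> because contraction changes both.\<close>

lemma cone_series_forest_poly:
  fixes V :: "'v::finite set" and E :: "'e::finite set"
  assumes "\<forall>f\<in>E. fst (ends f) \<in> V \<and> snd (ends f) \<in> V"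
  shows "cone_series V E ends * (1 - fps_X) ^ (card V + card E) = fps_of_poly (forest_poly E ends)"
  using finite[of E] assms
proof (induction E arbitrary: V ends rule: finite_induct)
  case empty
  then show ?case by (simp add: cone_series_empty forest_poly_empty)
next
  case (insert f E)
  obtain u v where uv: "ends f = (u, v)" by force
  have V: "u \<in> V" "v \<in> V" using insert uv by auto
  let ?A = "Abs_fps (\<lambda>i. if i = 0 then 1 else 2) :: int fps" and ?B = "Abs_fps (\<lambda>i. 2 * int i)"
  let ?X = "fps_X :: int fps"
  have A: "?A * (1 - ?X) = 1 + ?X"
  proof (rule fps_ext)
    fix n show "fps_nth (?A * (1 - ?X)) n = fps_nth (1 + ?X) n"
      by (cases n) (auto simp: right_diff_distrib)
  qed
  have B: "?B * (1 - ?X) ^ 2 = 2 * ?X"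
  proof -
    have "?B * (1 - ?X) = 2 * ?X * Abs_fps (\<lambda>_. 1)"
    proof (rule fps_ext)
      fix n show "fps_nth (?B * (1 - ?X)) n = fps_nth (2 * ?X * Abs_fps (\<lambda>_. 1)) n"
        by (cases n) (simp_all add: right_diff_distrib mult.assoc numeral_fps_const)
    qed
    moreover have "Abs_fps (\<lambda>_. 1) * (1 - ?X) = 1"
    proof (rule fps_ext)
      fix n show "fps_nth (Abs_fps (\<lambda>_. 1) * (1 - ?X)) n = fps_nth 1 n"
        by (cases n) (simp_all add: right_diff_distrib)
    qed
    ultimately have "?B * (1 - ?X) * (1 - ?X) = 2 * ?X" by (simp only: mult.assoc mult_1_right)
    then show ?thesis by (simp only: power2_eq_square mult.assoc)
  qed
  have pA: "fps_of_poly [:1, 1:] = 1 + ?X" and pB: "fps_of_poly [:0, 2:] = 2 * ?X"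
    by (simp_all add: fps_of_poly_pCons numeral_fps_const)
  let ?P = "1 - ?X" and ?n = "card V + card E"
  have first: "?A * cone_series V E ends * ?P ^ (card V + card (insert f E))
      = fps_of_poly ([:1, 1:] * forest_poly E ends)"
  proof -
    have "?A * cone_series V E ends * ?P ^ (card V + card (insert f E))
      = (?A * ?P) * (cone_series V E ends * ?P ^ ?n)"
      by (simp only: card_insert_disjoint[OF insert.hyps] add_Suc_right power_Suc ac_simps)
    also have "cone_series V E ends * ?P ^ ?n = fps_of_poly (forest_poly E ends)"
      by (rule insert.IH) (use insert.prems in auto)
    finally show ?thesis by (simp only: A fps_of_poly_mult pA)
  qed
  have second: "?B * cone_series (V - {v}) E (contract u v ends) * ?P ^ (card V + card (insert f E))
      = fps_of_poly ([:0, 2:] * forest_poly E (contract u v ends))" if "u \<noteq> v"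
  proof -
    have "card V = Suc (card (V - {v}))" using V by (metis card_Suc_Diff1 finite)
    then have "?P ^ (card V + card (insert f E)) = ?P ^ 2 * ?P ^ (card (V - {v}) + card E)"
      by (simp only: card_insert_disjoint[OF insert.hyps] add_Suc_right add_Suc power_Suc power2_eq_square mult.assoc)
    then have "?B * cone_series (V - {v}) E (contract u v ends) * ?P ^ (card V + card (insert f E))
      = (?B * ?P ^ 2) * (cone_series (V - {v}) E (contract u v ends) * ?P ^ (card (V - {v}) + card E))"
      by (simp only: ac_simps)
    moreover have "\<forall>g\<in>E. fst (contract u v ends g) \<in> V - {v} \<and> snd (contract u v ends g) \<in> V - {v}"
      using insert V that by (auto simp: contract_def)
    then have "cone_series (V - {v}) E (contract u v ends) * ?P ^ (card (V - {v}) + card E)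
      = fps_of_poly (forest_poly E (contract u v ends))" by (rule insert.IH)
    ultimately show ?thesis by (simp only: B fps_of_poly_mult pB)
  qed
  show ?case
    unfolding cone_series_insert[of f E ends u v V, OF insert.hyps(2) uv V] forest_poly_insert[of E f ends u v, OF insert.hyps uv]
    using first second by (auto simp: distrib_right fps_of_poly_add simp del: mult_pCons_left)
qed

section \<open>Lattice points and dimension of the polytope\<close>

lemma dilate_add:
  fixes C :: "'a::real_vector set"
  assumes "convex C" "0 \<le> a" "0 \<le> b" "p \<in> (\<lambda>c. a *\<^sub>R c) ` C" "q \<in> (\<lambda>c. b *\<^sub>R c) ` C"
  shows "p + q \<in> (\<lambda>c. (a + b) *\<^sub>R c) ` C"
proof -
  obtain c d where cd: "c \<in> C" "d \<in> C" "p = a *\<^sub>R c" "q = b *\<^sub>R d" using assms by auto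
  show ?thesis
  proof (cases "a + b = 0")
    case True
    then have "a = 0" "b = 0" using assms by auto
    then show ?thesis using cd by auto
  next
    case False
    have "(a / (a + b)) *\<^sub>R c + (b / (a + b)) *\<^sub>R d \<in> C"
      using assms cd False by (intro convexD) (auto simp flip: add_divide_distrib)
    moreover have "p + q = (a + b) *\<^sub>R ((a / (a + b)) *\<^sub>R c + (b / (a + b)) *\<^sub>R d)"
      using cd False by (simp add: scaleR_right_distrib)
    ultimately show ?thesis by blast
  qed
qed

text \<open>The inverse of the substitution: \<open>max 0 (- y e)\<close> is given back to both ends
  of \<open>e\<close>. Adding the two indicators makes a loop count twice.\<close>

definition cosmo_point ::
  "('e::finite \<Rightarrow> 'v::finite \<times> 'v) \<Rightarrow> 'e set \<Rightarrow> ('v \<Rightarrow> int) \<Rightarrow> ('e \<Rightarrow> int) \<Rightarrow> real ^ ('v + 'e)" where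
  "cosmo_point ends E x y = (\<chi> s. case s of
     Inl a \<Rightarrow> real_of_int (x a + (\<Sum>e\<in>E. max 0 (- y e) * (of_bool (fst (ends e) = a) + of_bool (snd (ends e) = a))))
   | Inr e \<Rightarrow> real_of_int (y e))"

lemma cosmo_point_shift:
  "cosmo_point ends E (shift u v i x) y =
    cosmo_point ends E x y + real_of_int i *\<^sub>R (axis (Inl u) 1 - axis (Inl v) 1)"
  by (auto simp: vec_eq_iff cosmo_point_def shift_def axis_def algebra_simps split: sum.split)

lemma cosmo_point_insert:
  assumes f: "f \<notin> E" "ends f = (u, v)"
  shows "cosmo_point ends (insert f E) x y = cosmo_point ends E x (y(f := 0)) +
    (if y f \<le> 0 then real_of_int (- y f) *\<^sub>R (axis (Inl u) 1 + axis (Inl v) 1 - axis (Inr f) 1)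
     else real_of_int (y f) *\<^sub>R axis (Inr f) 1)" (is "_ = _ + ?r")
proof -
  let ?d = "\<lambda>y a e. max 0 (- y e) * (of_bool (fst (ends e) = a) + of_bool (snd (ends e) = a)) :: int"
  have "(\<Sum>e\<in>insert f E. ?d y a e) = ?d y a f + (\<Sum>e\<in>E. ?d (y(f := 0)) a e)" for a
    using f(1) by (simp add: sum.insert) (rule sum.cong, auto)
  then have "cosmo_point ends (insert f E) x y $ s = (cosmo_point ends E x (y(f := 0)) + ?r) $ s" for s
    by (cases s) (auto simp: cosmo_point_def axis_def f(2))
  then show ?thesis by (simp add: vec_eq_iff)
qed

lemma convex_cosmo: "convex (cosmological_polytope V E ends)"
  by (simp add: cosmological_polytope_def)

lemma gens_mem: "p \<in> cosmo_gens V E ends \<Longrightarrow> p \<in> cosmological_polytope V E ends"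
  by (simp add: cosmological_polytope_def hull_inc)

text \<open>Edges are peeled off one by one, each paying its share of the degree in generators.
  \<open>D\<close> varies while \<open>E\<close> stays fixed, so that all generators lie in one
  polytope.\<close>

lemma cosmo_point_mem:
  fixes V :: "'v::finite set" and E :: "'e::finite set" and ends :: "'e \<Rightarrow> 'v \<times> 'v"
  assumes V: "V \<noteq> {}" and D: "D \<subseteq> E"
    and supp: "\<forall>a. a \<notin> V \<longrightarrow> x a = 0" "\<forall>e. e \<notin> D \<longrightarrow> y e = 0"
    and ends: "\<forall>f\<in>E. fst (ends f) \<in> V \<and> snd (ends f) \<in> V"
    and cut: "\<forall>S. 0 \<le> cutval ends D x y S"
  shows "cosmo_point ends D x y \<in>
    (\<lambda>c. real_of_int (sum x UNIV + (\<Sum>e\<in>UNIV. \<bar>y e\<bar>)) *\<^sub>R c) ` cosmological_polytope V E ends"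
  using finite[of D] D supp cut
proof (induction D arbitrary: x y rule: finite_induct)
  case empty
  let ?C = "cosmological_polytope V E ends"
  have pos: "0 \<le> x a" for a using empty.prems(4)[rule_format, of "{a}"] by (simp add: cutval_def)
  obtain v where v: "v \<in> V" using V by blast
  have "(\<Sum>a\<in>W. real_of_int (x a) *\<^sub>R axis (Inl a) 1) \<in> (\<lambda>c. (\<Sum>a\<in>W. real_of_int (x a)) *\<^sub>R c) ` ?C"
    if "W \<subseteq> V" for W
    using finite[of W] that
  proof (induction W rule: finite_induct)
    case empty
    \<comment> \<open>The empty sum is 0, which lies in the dilate by 0 only because the polytope is
      nonempty.\<close>
    have "axis (Inl v) 1 \<in> ?C" by (rule gens_mem) (use v in \<open>auto simp: cosmo_gens_def\<close>)
    then show ?case by auto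
  next
    case (insert b W)
    have "axis (Inl b) 1 \<in> ?C" by (rule gens_mem) (use insert.prems in \<open>auto simp: cosmo_gens_def\<close>)
    then have b: "real_of_int (x b) *\<^sub>R axis (Inl b) 1 \<in> (\<lambda>c. real_of_int (x b) *\<^sub>R c) ` ?C" by (rule imageI)
    have "real_of_int (x b) *\<^sub>R axis (Inl b) 1 + (\<Sum>a\<in>W. real_of_int (x a) *\<^sub>R axis (Inl a) 1)
      \<in> (\<lambda>c. (real_of_int (x b) + (\<Sum>a\<in>W. real_of_int (x a))) *\<^sub>R c) ` ?C"
      by (rule dilate_add[OF convex_cosmo _ _ b]) (use insert pos in \<open>auto intro: sum_nonneg\<close>)
    then show ?case using insert by simp
  qed
  from this[of V] have "(\<Sum>a\<in>V. real_of_int (x a) *\<^sub>R axis (Inl a) 1) \<in> (\<lambda>c. (\<Sum>a\<in>V. real_of_int (x a)) *\<^sub>R c) ` ?C"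
    by simp
  moreover have "(\<Sum>a\<in>V. real_of_int (x a) *\<^sub>R axis (Inl a) 1) = cosmo_point ends {} x y"
  proof -
    have "(\<Sum>a\<in>V. real_of_int (x a) *\<^sub>R axis (Inl a) 1) $ s = cosmo_point ends {} x y $ s" for s
    proof (cases s)
      case (Inl b)
      have "(\<Sum>a\<in>V. real_of_int (x a) * (if b = a then 1 else 0)) = real_of_int (x b)"
        using empty.prems(2) by (simp add: if_distrib[of "(*) _"] sum.delta' cong: if_cong)
      then show ?thesis using Inl by (simp add: cosmo_point_def axis_def)
    qed (use empty.prems(3) in \<open>simp add: cosmo_point_def axis_def\<close>)
    then show ?thesis by (simp add: vec_eq_iff)
  qed
  moreover have "sum x V = sum x UNIV" using empty.prems(2) by (intro sum.mono_neutral_left) auto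
  moreover have "(\<Sum>e\<in>UNIV. \<bar>y e\<bar>) = 0" using empty.prems(3) by simp
  ultimately show ?case by (simp flip: of_int_sum)
next
  case (insert f D)
  let ?C = "cosmological_polytope V E ends"
  obtain u v where uv: "ends f = (u, v)" by force
  have fE: "f \<in> E" and uvV: "u \<in> V" "v \<in> V" using insert.prems(1) ends uv by auto
  define t where "t = y f"
  let ?y = "y(f := 0)"
  have cutD: "cutval ends D z ?y S = cutval ends D z y S" for z S
    using insert.hyps(2) unfolding cutval_def by (intro arg_cong2[where f = plus] sum.cong) auto
  obtain i where i: "\<bar>i\<bar> \<le> max 0 t" "\<forall>S. 0 \<le> cutval ends D (shift u v i x) ?y S"
    using insert.prems(4) unfolding cut_insert_iff[of f D ends u v, OF insert.hyps(2) uv] cutD t_def by blast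
  let ?x = "shift u v i x"
  have "\<forall>a. a \<notin> V \<longrightarrow> ?x a = 0" using insert.prems(2) uvV by (auto simp: shift_def)
  moreover have "\<forall>e. e \<notin> D \<longrightarrow> ?y e = 0" using insert.prems(3) by auto
  ultimately have IH: "cosmo_point ends D ?x ?y \<in> (\<lambda>c. real_of_int (sum ?x UNIV + (\<Sum>e\<in>UNIV. \<bar>?y e\<bar>)) *\<^sub>R c) ` ?C"
    using insert.IH[of ?x ?y] insert.prems(1) i(2) by blast
  have sx: "sum ?x UNIV = sum x UNIV" by (simp add: sum_shift)
  have sy: "(\<Sum>e\<in>UNIV. \<bar>y e\<bar>) = (\<Sum>e\<in>UNIV. \<bar>?y e\<bar>) + \<bar>t\<bar>"
    by (simp add: sum.remove[of UNIV f] t_def)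
  define d where "d = sum x UNIV + (\<Sum>e\<in>UNIV. \<bar>?y e\<bar>)"
  have "0 \<le> sum ?x UNIV" using i(2)[rule_format, of UNIV] by (simp add: cutval_def)
  moreover have "0 \<le> (\<Sum>e\<in>UNIV. \<bar>?y e\<bar>)" by (rule sum_nonneg) simp
  ultimately have "0 \<le> d" unfolding d_def sx by linarith
  then have d: "0 \<le> real_of_int d" by simp
  have IH': "cosmo_point ends D ?x ?y \<in> (\<lambda>c. real_of_int d *\<^sub>R c) ` ?C" using IH unfolding sx d_def by simp
  have gen: "axis (Inr f) 1 \<in> ?C" "axis (Inl u) 1 + axis (Inl v) 1 - axis (Inr f) 1 \<in> ?C"
    "axis (Inl u) 1 - axis (Inl v) 1 + axis (Inr f) 1 \<in> ?C" "- axis (Inl u) 1 + axis (Inl v) 1 + axis (Inr f) 1 \<in> ?C"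
  proof -
    have "u = fst (ends f)" "v = snd (ends f)" using uv by auto
    then show "axis (Inr f) 1 \<in> ?C" "axis (Inl u) 1 + axis (Inl v) 1 - axis (Inr f) 1 \<in> ?C"
      "axis (Inl u) 1 - axis (Inl v) 1 + axis (Inr f) 1 \<in> ?C" "- axis (Inl u) 1 + axis (Inl v) 1 + axis (Inr f) 1 \<in> ?C"
      using fE by (intro gens_mem; unfold cosmo_gens_def; blast)+
  qed
  have "cosmo_point ends (insert f D) x y \<in> (\<lambda>c. (real_of_int d + real_of_int \<bar>t\<bar>) *\<^sub>R c) ` ?C"
  proof (cases "t \<le> 0")
    case True
    then have "i = 0" using i(1) by simp
    then have "cosmo_point ends (insert f D) x y = cosmo_point ends D ?x ?y
      + real_of_int \<bar>t\<bar> *\<^sub>R (axis (Inl u) 1 + axis (Inl v) 1 - axis (Inr f) 1)"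
      using True cosmo_point_insert[of f D ends u v x y, OF insert.hyps(2) uv] by (simp add: t_def)
    then show ?thesis using dilate_add[OF convex_cosmo d _ IH' imageI[OF gen(2)], of "real_of_int \<bar>t\<bar>"] by simp
  next
    case False
    \<comment> \<open>Undoing the shift by \<open>i\<close> costs \<open>\<bar>i\<bar>\<close>
      copies of the arrow generator \<open>g\<close>, whose direction is given by the sign of
      \<open>i\<close>; the remaining \<open>t - \<bar>i\<bar>\<close> units at \<open>f\<close> are
      copies of \<open>axis (Inr f) 1\<close>.\<close>
    define g :: "real ^ ('v + 'e)" where "g = (if 0 \<le> i then - axis (Inl u) 1 + axis (Inl v) 1 + axis (Inr f) 1
      else axis (Inl u) 1 - axis (Inl v) 1 + axis (Inr f) 1)"
    have "g \<in> ?C" using gen by (simp add: g_def)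
    have "\<bar>i\<bar> \<le> t" using False i(1) by simp
    then have ti: "0 \<le> real_of_int (t - \<bar>i\<bar>)" by simp
    have 1: "real_of_int \<bar>i\<bar> *\<^sub>R g + real_of_int (t - \<bar>i\<bar>) *\<^sub>R axis (Inr f) 1
      \<in> (\<lambda>c. (real_of_int \<bar>i\<bar> + real_of_int (t - \<bar>i\<bar>)) *\<^sub>R c) ` ?C"
      by (rule dilate_add[OF convex_cosmo _ ti imageI[OF \<open>g \<in> ?C\<close>] imageI[OF gen(1)]]) simp
    have tt: "real_of_int \<bar>i\<bar> + real_of_int (t - \<bar>i\<bar>) = real_of_int \<bar>t\<bar>" using False by simp
    have "cosmo_point ends (insert f D) x y = cosmo_point ends D ?x ?y
      + (real_of_int \<bar>i\<bar> *\<^sub>R g + real_of_int (t - \<bar>i\<bar>) *\<^sub>R axis (Inr f) 1)"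
    proof -
      have "cosmo_point ends (insert f D) x y = cosmo_point ends D x ?y + real_of_int t *\<^sub>R axis (Inr f) 1"
        using False cosmo_point_insert[of f D ends u v x y, OF insert.hyps(2) uv] by (simp add: t_def)
      then show ?thesis unfolding cosmo_point_shift
        by (cases "0 \<le> i") (simp_all add: g_def algebra_simps)
    qed
    then show ?thesis using dilate_add[OF convex_cosmo d _ IH' 1[unfolded tt]] by simp
  qed
  moreover have "real_of_int (sum x UNIV + (\<Sum>e\<in>UNIV. \<bar>y e\<bar>)) = real_of_int d + real_of_int \<bar>t\<bar>"
    unfolding sy d_def by simp
  ultimately show ?case by simp
qed


text \<open>The facets of the polytope belong to connected subgraphs (S, H). This is the minimum over H
  of their functionals, hence concave in z, and it becomes the cut value after the substitution.\<close>

definition facet_value :: "('e::finite \<Rightarrow> 'v::finite \<times> 'v) \<Rightarrow> 'e set \<Rightarrow> real ^ ('v + 'e) \<Rightarrow> 'v set \<Rightarrow> real" where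
  "facet_value ends E z S = (\<Sum>a\<in>S. z $ Inl a) +
    (\<Sum>e\<in>E. if fst (ends e) \<in> S \<and> snd (ends e) \<in> S then 2 * min 0 (z $ Inr e)
      else if fst (ends e) \<in> S \<or> snd (ends e) \<in> S then z $ Inr e else 0)"

lemma facet_value_scale: "0 \<le> r \<Longrightarrow> facet_value ends E (r *\<^sub>R z) S = r * facet_value ends E z S"
proof -
  assume r: "0 \<le> r"
  have "min 0 (r * t) = r * min 0 t" for t using r by (simp add: min_mult_distrib_left)
  then show ?thesis
    unfolding facet_value_def distrib_left sum_distrib_left
    by (intro arg_cong2[where f = plus] sum.cong) auto
qed

lemma facet_value_superadditive:
  "facet_value ends E z S + facet_value ends E z' S \<le> facet_value ends E (z + z') S"
proof -
  have "2 * min 0 s + 2 * min 0 t \<le> 2 * min 0 (s + t)" for s t :: real by (simp add: min_def)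
  then show ?thesis
    unfolding facet_value_def add.assoc
    by (simp add: sum.distrib add.left_commute[of _ "sum _ S"] flip: add.assoc)
       (simp only: sum.distrib[symmetric] add.assoc, intro sum_mono, auto)
qed

lemma convex_facet_value_nonneg: "convex {z. 0 \<le> facet_value ends E z S}"
proof (rule convexI)
  fix z z' and r s :: real
  assume z: "z \<in> {z. 0 \<le> facet_value ends E z S}" "z' \<in> {z. 0 \<le> facet_value ends E z S}" and rs: "0 \<le> r" "0 \<le> s"
  then have "0 \<le> facet_value ends E (r *\<^sub>R z) S" "0 \<le> facet_value ends E (s *\<^sub>R z') S"
    by (simp_all add: facet_value_scale)
  then show "r *\<^sub>R z + s *\<^sub>R z' \<in> {z. 0 \<le> facet_value ends E z S}"
    using facet_value_superadditive[of ends E "r *\<^sub>R z" S "s *\<^sub>R z'"] by simp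
qed

lemma cosmo_gens_cases:
  assumes "z \<in> cosmo_gens V E ends"
  obtains f where "f \<in> E" "z = axis (Inr f) 1"
  | f where "f \<in> E" "z = axis (Inl (fst (ends f))) 1 + axis (Inl (snd (ends f))) 1 - axis (Inr f) 1"
  | f where "f \<in> E" "z = axis (Inl (fst (ends f))) 1 - axis (Inl (snd (ends f))) 1 + axis (Inr f) 1"
  | f where "f \<in> E" "z = - axis (Inl (fst (ends f))) 1 + axis (Inl (snd (ends f))) 1 + axis (Inr f) 1"
  | u where "u \<in> V" "z = axis (Inl u) 1"
  using assms unfolding cosmo_gens_def by blast

text \<open>All edge generators have this shape, with \<open>u\<close>, \<open>v\<close> the ends of
  \<open>f\<close> and coefficients 1, -1 or 0. The case \<open>u = v\<close> is included, for
  loops.\<close>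

lemma facet_value_gen:
  assumes "f \<in> E"
  shows "facet_value ends E (a *\<^sub>R axis (Inl u) 1 + b *\<^sub>R axis (Inl v) 1 + c *\<^sub>R axis (Inr f) 1) S =
    a * of_bool (u \<in> S) + b * of_bool (v \<in> S) +
    (if fst (ends f) \<in> S \<and> snd (ends f) \<in> S then 2 * min 0 c
     else if fst (ends f) \<in> S \<or> snd (ends f) \<in> S then c else 0)" (is "facet_value ends E ?z S = _")
proof -
  have "(\<Sum>x\<in>S. a * (if x = u then 1 else 0) + b * (if x = v then 1 else 0)) = a * of_bool (u \<in> S) + b * of_bool (v \<in> S)"
    by (simp add: sum.distrib flip: sum_distrib_left)
  moreover have "(\<Sum>e\<in>E. if fst (ends e) \<in> S \<and> snd (ends e) \<in> S then 2 * min 0 (c * (if e = f then 1 else 0))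
      else if fst (ends e) \<in> S \<or> snd (ends e) \<in> S then c * (if e = f then 1 else 0) else 0) =
    (\<Sum>e\<in>E. if e = f then (if fst (ends f) \<in> S \<and> snd (ends f) \<in> S then 2 * min 0 c
      else if fst (ends f) \<in> S \<or> snd (ends f) \<in> S then c else 0) else 0)"
    by (rule sum.cong) auto
  moreover have nth: "?z $ Inl x = a * (if x = u then 1 else 0) + b * (if x = v then 1 else 0)"
    "?z $ Inr e = c * (if e = f then 1 else 0)" for x e
    by (simp_all add: axis_def)
  ultimately show ?thesis using assms unfolding facet_value_def nth by simp
qed

lemma facet_value_cosmo_gens:
  assumes "z \<in> cosmo_gens V E ends"
  shows "0 \<le> facet_value ends E z S"
  using assms
proof (cases rule: cosmo_gens_cases)
  case (1 f)
  then show ?thesis using facet_value_gen[of f E ends 0 _ 0 _ 1 S] by simp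
next
  case (2 f)
  then show ?thesis
    using facet_value_gen[of f E ends 1 "fst (ends f)" 1 "snd (ends f)" "- 1" S] by auto
next
  case (3 f)
  then show ?thesis
    using facet_value_gen[of f E ends 1 "fst (ends f)" "- 1" "snd (ends f)" 1 S] by auto
next
  case (4 f)
  then show ?thesis
    using facet_value_gen[of f E ends "- 1" "fst (ends f)" 1 "snd (ends f)" 1 S] by auto
next
  case (5 u)
  then show ?thesis by (auto simp: facet_value_def axis_def intro!: add_nonneg_nonneg sum_nonneg)
qed

lemma sum_plus_type: "(\<Sum>s\<in>UNIV. g s) = (\<Sum>a\<in>UNIV. g (Inl a)) + (\<Sum>e\<in>UNIV. g (Inr e))"
  for g :: "'v::finite + 'e::finite \<Rightarrow> 'c::comm_monoid_add"
  by (subst UNIV_Plus_UNIV[symmetric], subst sum.Plus) (simp_all add: o_def)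

lemma sum_axis: "(\<Sum>s\<in>UNIV. (axis t 1 :: real ^ 'n::finite) $ s) = 1"
  by (simp add: axis_def)

text \<open>Each condition defines a convex set containing the generators, hence holds on their
  hull.\<close>

lemma cosmological_polytope_bounds:
  fixes V :: "'v::finite set" and E :: "'e::finite set" and ends :: "'e \<Rightarrow> 'v \<times> 'v"
  assumes ends: "\<forall>f\<in>E. fst (ends f) \<in> V \<and> snd (ends f) \<in> V"
    and z: "z \<in> cosmological_polytope V E ends"
  shows "0 \<le> facet_value ends E z S" "a \<notin> V \<Longrightarrow> z $ Inl a = 0" "e \<notin> E \<Longrightarrow> z $ Inr e = 0"
    "(\<Sum>s\<in>UNIV. z $ s) = 1"
proof -
  have hull: "z \<in> A" if "convex A" "cosmo_gens V E ends \<subseteq> A" for A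
    using hull_minimal[of "cosmo_gens V E ends" A convex] that z unfolding cosmological_polytope_def by blast
  have "z \<in> {z. 0 \<le> facet_value ends E z S}"
    by (rule hull[OF convex_facet_value_nonneg]) (auto intro: facet_value_cosmo_gens)
  then show "0 \<le> facet_value ends E z S" by simp
  show "z $ Inl a = 0" if a: "a \<notin> V"
  proof -
    have "z \<in> {z. z $ Inl a = 0}"
      by (rule hull) (use a ends in \<open>auto simp: convex_def cosmo_gens_def axis_def\<close>)
    then show ?thesis by simp
  qed
  show "z $ Inr e = 0" if e: "e \<notin> E"
  proof -
    have "z \<in> {z. z $ Inr e = 0}"
      by (rule hull) (use e in \<open>auto simp: convex_def cosmo_gens_def axis_def\<close>)
    then show ?thesis by simp
  qed
  have "z \<in> {z. (\<Sum>s\<in>UNIV. z $ s) = 1}"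
  proof (rule hull)
    show "convex {z :: real ^ ('v + 'e). (\<Sum>s\<in>UNIV. z $ s) = 1}"
      by (rule convexI) (simp add: sum.distrib flip: sum_distrib_left)
    show "cosmo_gens V E ends \<subseteq> {z. (\<Sum>s\<in>UNIV. z $ s) = 1}"
      by (auto simp: cosmo_gens_def sum.distrib sum_subtractf sum_negf sum_axis)
  qed
  then show "(\<Sum>s\<in>UNIV. z $ s) = 1" by simp
qed

text \<open>Edge by edge: with both ends in \<open>S\<close> the terms
  \<open>2 * max 0 (- y e)\<close> and \<open>2 * min 0 (y e)\<close> cancel, with one end
  \<open>max 0 (- y e) + y e = max 0 (y e)\<close>, and with none all vanish.\<close>

lemma facet_value_cosmo_point:
  "facet_value ends E (cosmo_point ends E x y) S = real_of_int (cutval ends E x y S)"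
proof -
  have "(\<Sum>a\<in>S. \<Sum>e\<in>E. max 0 (- y e) * (of_bool (fst (ends e) = a) + of_bool (snd (ends e) = a)))
    = (\<Sum>e\<in>E. max 0 (- y e) * (of_bool (fst (ends e) \<in> S) + of_bool (snd (ends e) \<in> S)))"
  proof (subst sum.swap, rule sum.cong[OF refl])
    fix e
    have "(\<Sum>a\<in>S. of_bool (b = a) :: int) = of_bool (b \<in> S)" for b by (simp add: of_bool_def)
    then show "(\<Sum>a\<in>S. max 0 (- y e) * (of_bool (fst (ends e) = a) + of_bool (snd (ends e) = a)))
      = max 0 (- y e) * (of_bool (fst (ends e) \<in> S) + of_bool (snd (ends e) \<in> S))"
      by (simp add: sum.distrib flip: sum_distrib_left)
  qed
  then have "(\<Sum>a\<in>S. cosmo_point ends E x y $ Inl a) = real_of_int (sum x S +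
      (\<Sum>e\<in>E. max 0 (- y e) * (of_bool (fst (ends e) \<in> S) + of_bool (snd (ends e) \<in> S))))"
    by (simp add: cosmo_point_def sum.distrib flip: of_int_sum of_int_add)
  then have "facet_value ends E (cosmo_point ends E x y) S = real_of_int (sum x S) +
    (\<Sum>e\<in>E. real_of_int (max 0 (- y e) * (of_bool (fst (ends e) \<in> S) + of_bool (snd (ends e) \<in> S))) +
      (if fst (ends e) \<in> S \<and> snd (ends e) \<in> S then 2 * min 0 (cosmo_point ends E x y $ Inr e)
      else if fst (ends e) \<in> S \<or> snd (ends e) \<in> S then cosmo_point ends E x y $ Inr e else 0))"
    unfolding facet_value_def by (simp only: of_int_add of_int_sum sum.distrib add.assoc)
  also have "\<dots> = real_of_int (sum x S) +
    (\<Sum>e\<in>E. real_of_int (if (fst (ends e) \<in> S) = (snd (ends e) \<in> S) then 0 else max 0 (y e)))"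
    by (intro arg_cong2[where f = plus] sum.cong refl) (auto simp: cosmo_point_def max_def min_def)
  finally show ?thesis by (simp add: cutval_def)
qed


lemma sum_cosmo_point:
  assumes "\<forall>e. e \<notin> E \<longrightarrow> y e = 0"
  shows "(\<Sum>s\<in>UNIV. cosmo_point ends E x y $ s) = real_of_int (sum x UNIV + (\<Sum>e\<in>UNIV. \<bar>y e\<bar>))"
proof -
  have "(\<Sum>a\<in>UNIV. \<Sum>e\<in>E. max 0 (- y e) * (of_bool (fst (ends e) = a) + of_bool (snd (ends e) = a)))
    = (\<Sum>e\<in>E. 2 * max 0 (- y e))"
  proof (subst sum.swap, rule sum.cong[OF refl])
    fix e
    have "(\<Sum>a\<in>UNIV. of_bool (b = a) :: int) = 1" for b :: 'a by (simp add: of_bool_def)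
    then show "(\<Sum>a\<in>UNIV. max 0 (- y e) * (of_bool (fst (ends e) = a) + of_bool (snd (ends e) = a)))
      = 2 * max 0 (- y e)"
      by (simp add: sum.distrib flip: sum_distrib_left)
  qed
  also have "\<dots> = (\<Sum>e\<in>UNIV. 2 * max 0 (- y e))"
    using assms by (intro sum.mono_neutral_left) auto
  finally have "(\<Sum>s\<in>UNIV. cosmo_point ends E x y $ s) =
      real_of_int (sum x UNIV + (\<Sum>e\<in>UNIV. 2 * max 0 (- y e) + y e))"
    by (simp add: sum_plus_type cosmo_point_def sum.distrib add.assoc flip: of_int_sum of_int_add)
  also have "(\<Sum>e\<in>UNIV. 2 * max 0 (- y e) + y e) = (\<Sum>e\<in>UNIV. \<bar>y e\<bar>)"
    by (rule sum.cong) auto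
  finally show ?thesis .
qed

text \<open>The decomposition into generators gives one inclusion and the facet inequalities the
  other, so the cut conditions describe the dilates exactly at integer points.\<close>

lemma lattice_points_dilate:
  fixes V :: "'v::finite set" and E :: "'e::finite set" and ends :: "'e \<Rightarrow> 'v \<times> 'v"
  assumes V: "V \<noteq> {}" and ends: "\<forall>f\<in>E. fst (ends f) \<in> V \<and> snd (ends f) \<in> V"
  shows "{z. z \<in> (\<lambda>c. real j *\<^sub>R c) ` cosmological_polytope V E ends \<and> (\<forall>i. z $ i \<in> \<int>)} =
    (\<lambda>(x, y). cosmo_point ends E x y) ` cone_points V E ends j"
proof (intro equalityI subsetI)
  fix z assume "z \<in> (\<lambda>(x, y). cosmo_point ends E x y) ` cone_points V E ends j"
  then obtain x y where z: "z = cosmo_point ends E x y" and xy: "(x, y) \<in> cone_points V E ends j" by auto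
  then have "z \<in> (\<lambda>c. real_of_int (sum x UNIV + (\<Sum>e\<in>UNIV. \<bar>y e\<bar>)) *\<^sub>R c) ` cosmological_polytope V E ends"
    using cosmo_point_mem[OF V order_refl _ _ ends, of x y] by (simp add: cone_points_def)
  moreover have "sum x UNIV + (\<Sum>e\<in>UNIV. \<bar>y e\<bar>) = int j" using xy by (simp add: cone_points_def)
  moreover have "z $ i \<in> \<int>" for i by (cases i) (simp_all only: z cosmo_point_def vec_lambda_beta sum.case Ints_of_int)
  ultimately show "z \<in> {z. z \<in> (\<lambda>c. real j *\<^sub>R c) ` cosmological_polytope V E ends \<and> (\<forall>i. z $ i \<in> \<int>)}"
    by simp
next
  fix z assume z: "z \<in> {z. z \<in> (\<lambda>c. real j *\<^sub>R c) ` cosmological_polytope V E ends \<and> (\<forall>i. z $ i \<in> \<int>)}"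
  then obtain c where c: "c \<in> cosmological_polytope V E ends" "z = real j *\<^sub>R c" by auto
  note bounds = cosmological_polytope_bounds[OF ends c(1)]
  define y where "y e = \<lfloor>z $ Inr e\<rfloor>" for e
  define d where "d a = (\<Sum>e\<in>E. max 0 (- y e) * (of_bool (fst (ends e) = a) + of_bool (snd (ends e) = a)))" for a
  define x where "x a = \<lfloor>z $ Inl a\<rfloor> - d a" for a
  have int: "real_of_int \<lfloor>z $ i\<rfloor> = z $ i" for i using z by simp
  have zxy: "z = cosmo_point ends E x y"
  proof -
    have "z $ s = cosmo_point ends E x y $ s" for s
      by (cases s) (simp_all add: cosmo_point_def x_def d_def y_def int)
    then show ?thesis by (simp add: vec_eq_iff)
  qed
  have y: "\<forall>e. e \<notin> E \<longrightarrow> y e = 0" using bounds(3) c(2) by (simp add: y_def)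
  have "d a = 0" if "a \<notin> V" for a
    unfolding d_def by (rule sum.neutral) (use that ends in auto)
  then have x: "\<forall>a. a \<notin> V \<longrightarrow> x a = 0" using bounds(2) c(2) by (simp add: x_def)
  have "0 \<le> facet_value ends E z S" for S
    unfolding c(2) using bounds(1) by (simp add: facet_value_scale)
  then have "0 \<le> cutval ends E x y S" for S unfolding zxy facet_value_cosmo_point by simp
  moreover have "sum x UNIV + (\<Sum>e\<in>UNIV. \<bar>y e\<bar>) = int j"
  proof -
    have "real_of_int (sum x UNIV + (\<Sum>e\<in>UNIV. \<bar>y e\<bar>)) = (\<Sum>s\<in>UNIV. z $ s)"
      unfolding zxy sum_cosmo_point[OF y] ..
    also have "\<dots> = real j" unfolding c(2) using bounds(4) by (simp flip: sum_distrib_left)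
    finally show ?thesis by linarith
  qed
  ultimately have "(x, y) \<in> cone_points V E ends j" using x y by (simp add: cone_points_def)
  then show "z \<in> (\<lambda>(x, y). cosmo_point ends E x y) ` cone_points V E ends j" using zxy by force
qed

lemma inj_cosmo_point: "inj (\<lambda>(x, y). cosmo_point ends E x y)"
proof (rule injI, clarify, rule conjI)
  fix x y x' y' assume eq: "cosmo_point ends E x y = cosmo_point ends E x' y'"
  have "y e = y' e" for e using arg_cong[OF eq, of "\<lambda>z. z $ Inr e"] by (simp add: cosmo_point_def)
  then show "y = y'" ..
  then have "x a = x' a" for a using arg_cong[OF eq, of "\<lambda>z. z $ Inl a"] by (simp add: cosmo_point_def)
  then show "x = x'" ..
qed

lemma ehrhart_series_cosmological:
  fixes V :: "'v::finite set" and E :: "'e::finite set" and ends :: "'e \<Rightarrow> 'v \<times> 'v"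
  assumes "V \<noteq> {}" "\<forall>f\<in>E. fst (ends f) \<in> V \<and> snd (ends f) \<in> V"
  shows "ehrhart_series (cosmological_polytope V E ends) = cone_series V E ends"
  unfolding ehrhart_series_def cone_series_def lattice_count_def lattice_points_dilate[OF assms]
  by (simp add: card_image inj_on_subset[OF inj_cosmo_point])

text \<open>The unit vectors of nodes and edges are themselves generators and affinely independent;
  the other generators are affine combinations of them, with coefficients 1, 1, -1.\<close>

lemma aff_dim_cosmological:
  fixes V :: "'v::finite set" and E :: "'e::finite set" and ends :: "'e \<Rightarrow> 'v \<times> 'v"
  assumes ends: "\<forall>f\<in>E. fst (ends f) \<in> V \<and> snd (ends f) \<in> V"
  shows "aff_dim (cosmological_polytope V E ends) = int (card V + card E) - 1"
proof -
  let ?I = "Inl ` V \<union> Inr ` E :: ('v + 'e) set"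
  let ?B = "(\<lambda>s. axis s 1) ` ?I :: (real ^ ('v + 'e)) set"
  let ?G = "cosmo_gens V E ends"
  have "card ?B = card ?I"
    by (rule card_image) (auto simp: inj_on_def axis_eq_axis)
  also have "card ?I = card V + card E" by (subst card_Un_disjoint) (auto simp: card_image)
  finally have card: "card ?B = card V + card E" .
  have "independent ?B"
    by (rule independent_mono[OF independent_Basis]) (auto simp: axis_in_Basis_iff)
  then have "\<not> affine_dependent ?B" using affine_dependent_imp_dependent by (rule contrapos_nn)
  from aff_dim_affine_independent[OF this]
  have dim: "aff_dim ?B = int (card ?B) - 1" by linarith
  have l: "axis (Inl a) 1 \<in> affine hull ?B" if "a \<in> V" for a using that by (intro hull_inc) auto
  have r: "axis (Inr e) 1 \<in> affine hull ?B" if "e \<in> E" for e using that by (intro hull_inc) auto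
  have comb: "p *\<^sub>R a + q *\<^sub>R b + r *\<^sub>R c \<in> affine hull ?B"
    if "a \<in> affine hull ?B" "b \<in> affine hull ?B" "c \<in> affine hull ?B" "p + q + r = 1" for a b c p q r
    using that mem_affine_3[OF affine_affine_hull] by blast
  have "?G \<subseteq> affine hull ?B"
  proof
    fix z assume "z \<in> ?G"
    then show "z \<in> affine hull ?B"
    proof (cases rule: cosmo_gens_cases)
      case (2 f)
      then show ?thesis
        using comb[of "axis (Inl (fst (ends f))) 1" "axis (Inl (snd (ends f))) 1" "axis (Inr f) 1" 1 1 "-1"] l r ends by simp
    next
      case (3 f)
      then show ?thesis
        using comb[of "axis (Inl (fst (ends f))) 1" "axis (Inl (snd (ends f))) 1" "axis (Inr f) 1" 1 "-1" 1] l r ends by simp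
    next
      case (4 f)
      then show ?thesis
        using comb[of "axis (Inl (fst (ends f))) 1" "axis (Inl (snd (ends f))) 1" "axis (Inr f) 1" "-1" 1 1] l r ends by simp
    qed (use l r in auto)
  qed
  then have "affine hull ?G \<subseteq> affine hull ?B" by (rule hull_minimal) simp
  moreover have "?B \<subseteq> ?G" unfolding cosmo_gens_def by blast
  then have "affine hull ?B \<subseteq> affine hull ?G" by (rule hull_mono)
  ultimately have "affine hull ?G = affine hull ?B" by blast
  then have "aff_dim ?G = aff_dim ?B" by (metis aff_dim_affine_hull)
  then show ?thesis unfolding cosmological_polytope_def aff_dim_convex_hull dim card by simp
qed

theorem mainTheorem16:
  fixes V :: "'v::finite set" and E :: "'e::finite set" and ends :: "'e \<Rightarrow> 'v \<times> 'v"
  assumes "V \<noteq> {}" and "\<forall>f\<in>E. fst (ends f) \<in> V \<and> snd (ends f) \<in> V"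
  shows "h_star (cosmological_polytope V E ends) =
    (\<Sum>H\<in>bridgeless_poset E ends.
        smult (mobius (bridgeless_poset E ends) {} H)
          ([:0, 2:] ^ card H * [:1, 3:] ^ (card E - card H)))"
proof -
  \<comment> \<open>Makes the dimension nonnegative, so that \<open>nat\<close> in
    \<open>h_star\<close> does not truncate it.\<close>
  have "0 < card V" using assms(1) by (simp add: card_gt_0_iff)
  then have "nat (aff_dim (cosmological_polytope V E ends)) + 1 = card V + card E"
    unfolding aff_dim_cosmological[OF assms(2)] by simp
  then have "ehrhart_series (cosmological_polytope V E ends) *
      (1 - fps_X) ^ (nat (aff_dim (cosmological_polytope V E ends)) + 1) = fps_of_poly (forest_poly E ends)"
    by (simp only: ehrhart_series_cosmological[OF assms] cone_series_forest_poly[OF assms(2)])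
  \<comment> \<open>\<open>fps_of_poly\<close> is injective, so the polynomial described in
    \<open>h_star\<close> is unique.\<close>
  then have "h_star (cosmological_polytope V E ends) = forest_poly E ends"
    unfolding h_star_def by (simp only: fps_of_poly_eq_iff the_eq_trivial)
  then show ?thesis by (simp only: mobius_expansion)
qed

end
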